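(* Let $x^*\in\mathcal X$ be a solution of the variational inequality: $\langle g(x^* ),x-x^*\rangle\ge 0$ for all $x\in\mathcal X$. Assume: (1) $g:\mathcal X\to\mathcal Y$ is $L$-Lipschitz: $\|g(x')-g(x)\|_*\le L\|x'-x\|$ for all $x,x'\in\mathcal X$; (2) there are a convex neighborhood $\mathcal B$ of $x^*$ in $\mathcal X$ and $\mu>0$ with $\langle g(x)-g(x^* ),x-x^*\rangle\ge\mu\|x-x^*\|^2$ for all $x\in\mathcal B$; (3) $h$ is a Bregman regularizer on $\mathcal X$ that is tight at $x^*$, with Legendre exponent $\beta^*=\beta_h(x^* )\in[0,1)$; $\mathcal U$ is a neighborhood of $x^*$ in $\mathcal X$ and $K>0$ a constant such that $D(x^*,x)\le\frac K2\|x-x^*\|^{2(1-\beta^* )}$ for all $x\in\mathcal U\cap\mathcal X_h$, and $h$ is $1$-strongly convex on $\mathcal U$; (4) the sequences $x_t,x_{t+1/2}$ are generated by the Bregman proximal method (BPM) with parameters $\lambda_a,\lambda_b$ and constant step-size $\gamma_t\equiv\gamma>0$, where $$\gamma\le\frac1{2\varphi L}\quad\text{and}\quad \gamma(1-\lambda_a-\lambda_b)^2\le\frac{\mu}{8L^2},\qquad \varphi=\frac{\sqrt5+1}{2}.$$ Then, if $x_1$ is initialized sufficiently close to $x^*$ (i.e., there is a neighborhood $\mathcal U_1$ of $x^*$ in $\mathcal X$ such that the following holds whenever $x_1\in\mathcal U_1\cap\mathcal X_h$), the iterates satisfy for all $t=1,2,\dots$ $$D(x^*,x_t)\le D(x^*,x_1)\cdot\begin{cases}\left(1-\dfrac{\mu\gamma}{2K}\right)^{t-1}&\text{if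 }\beta^*=0,\\[2mm] \left[1+\rho\,\mu\gamma\,(t-1)\right]^{1-1/\beta^*}&\text{if }\beta^*\in(0,1),\end{cases}$$ where $$\rho=\frac{\beta^*}{1-\beta^*}\,\Big(\max\big\{2K^{\frac1{1-\beta^*}}D(x^*,x_1)^{-\frac{\beta^*}{1-\beta^*}},\;2^{\frac{\beta^*}{1-\beta^*}}\big\}\Big)^{-1}.$$
   Context: Setting. $\mathcal V$ is a finite-dimensional real vector space with norm $\|\cdot\|$, $\mathcal X\subseteq\mathcal V$ is closed and convex, $\mathcal Y=\mathcal V^*$ is the dual, $\langle y,x\rangle$ the canonical pairing, $\|y\|_*=\max\{\langle y,x\rangle:\|x\|\le1\}$ the dual norm. Bregman regularizer on $\mathcal X$: a proper, lower semicontinuous, strictly convex $h:\mathcal V\to\mathbb R\cup\{\infty\}$ such that (i) $\operatorname{dom}h=\mathcal X$; (ii) there is a continuous map $\nabla h:\operatorname{dom}\partial h\to\mathcal Y$ with $\nabla h(x)\in\partial h(x)$ for all $x\in\operatorname{dom}\partial h$ (a continuous selection, which is fixed); (iii) $h$ is locally strongly convex: for every compact $\mathcal K\subseteq\operatorname{dom}h$ there is $\kappa>0$ with $h(x')\ge h(x)+\langle\nabla h(x),x'-x\rangle+\frac\kappa2\|x'-x\|^2$ for all $x\in\mathcal K\cap\operatorname{dom}\partial h$, $x'\in\mathcal K$. "$h$ is $1$-strongly convex on $\mathcal U$" means this inequality holds with $\kappa=1$ for all $x\in\mathcal U\cap\operatorname{dom}\partial h$, $x'\in\mathcal U$. Prox-domain: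 $\mathcal X_h=\operatorname{dom}\partial h$. Bregman divergence: $D(p,x)=h(p)-h(x)-\langle\nabla h(x),p-x\rangle$ for $p\in\mathcal X$, $x\in\mathcal X_h$. Prox-mapping: $P_x(y)=\arg\min_{x'\in\mathcal X}\{\langle y,x-x'\rangle+D(x',x)\}$ for $x\in\mathcal X_h$, $y\in\mathcal Y$; it is assumed to be well-defined whenever it is invoked. Legendre exponent: $\beta_h(p)=\inf\{\beta\in[0,1]:\limsup_{x\to p}\sqrt{D(p,x)}/\|x-p\|^{1-\beta}<\infty\}$ (limit over $x\in\mathcal X_h$). $h$ is tight at $p$ if the infimum is attained, so that $D(p,x)=O(\|p-x\|^{2(1-\beta_h(p))})$ for $x$ near $p$. (BPM): with $x_{1/2}=x_1\in\mathcal X_h$ and for $t=1,2,\dots$, $$x_{t+1/2}=P_{x_t}(-\gamma_t g_t),\qquad x_{t+1}=P_{x_t}(-\gamma_t g_{t+1/2}),$$ where $g_{t+1/2}=g(x_{t+1/2})$ and $g_t=\lambda_a g(x_t)+\lambda_b g(x_{t-1/2})$, for fixed $\lambda_a,\lambda_b\in[0,1]$ with $\lambda_a+\lambda_b\le1$, and $\lambda_a+\lambda_b=1$ if $\lambda_b>0$. Convention: $\rho$ is read as $0$ if $D(x^*,x_1)=0$. *)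

theory Defs
  imports "HOL-Analysis.Analysis"
begin

text \<open>
  The ambient space is a finite-dimensional type \<open>'v :: real_normed_vector\<close>, with its own
  (arbitrary) norm. Its dual is \<open>'v \<Rightarrow>\<^sub>L real\<close>, the pairing of \<open>y\<close> and \<open>x\<close> is \<open>blinfun_apply y x\<close>,
  and the operator norm is the dual norm:
\<close>

lemma dual_norm_eq_SUP:
  fixes y :: "'v::real_normed_vector \<Rightarrow>\<^sub>L real"
  shows "norm y = (SUP x\<in>{x. norm x \<le> 1}. blinfun_apply y x)"
proof (rule antisym)
  have le: "blinfun_apply y x \<le> norm y" if "norm x \<le> 1" for x
  proof -
    have "blinfun_apply y x \<le> norm y * norm x"
      using norm_blinfun[of y x] by simp
    also have "\<dots> \<le> norm y * 1"
      using that by (intro mult_left_mono) auto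
    finally show ?thesis by simp
  qed
  have bdd: "bdd_above (blinfun_apply y ` {x. norm x \<le> 1})"
    using le by (intro bdd_aboveI[of _ "norm y"]) auto
  have zero_in: "(0::'v) \<in> {x. norm x \<le> 1}" by simp
  show "(SUP x\<in>{x. norm x \<le> 1}. blinfun_apply y x) \<le> norm y"
    using zero_in le by (intro cSUP_least) blast+
  have ub: "blinfun_apply y x \<le> (SUP x\<in>{x. norm x \<le> 1}. blinfun_apply y x)"
    if "norm x \<le> 1" for x
    using that bdd by (intro cSUP_upper) auto
  show "norm y \<le> (SUP x\<in>{x. norm x \<le> 1}. blinfun_apply y x)"
  proof (rule norm_blinfun_bound)
    show "0 \<le> (SUP x\<in>{x. norm x \<le> 1}. blinfun_apply y x)"
      using ub[of 0] by (simp add: blinfun.zero_right)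
    fix x
    show "norm (blinfun_apply y x) \<le> (SUP x\<in>{x. norm x \<le> 1}. blinfun_apply y x) * norm x"
    proof (cases "x = 0")
      case True
      then show ?thesis by (simp add: blinfun.zero_right)
    next
      case False
      then show ?thesis
        using ub[of "x /\<^sub>R norm x"] ub[of "- x /\<^sub>R norm x"]
        by (simp add: blinfun.scaleR_right blinfun.minus_right divide_simps abs_le_iff mult.commute)
    qed
  qed
qed

definition nhd_in :: "'v::topological_space set \<Rightarrow> 'v \<Rightarrow> 'v set \<Rightarrow> bool" where
  "nhd_in X p U \<longleftrightarrow> U \<subseteq> X \<and> (\<exists>W. openin (top_of_set X) W \<and> p \<in> W \<and> W \<subseteq> U)"

definition eff_dom :: "('v \<Rightarrow> ereal) \<Rightarrow> 'v set" where
  "eff_dom h = {x. h x < \<infinity>}"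

definition proper_fun :: "('v \<Rightarrow> ereal) \<Rightarrow> bool" where
  "proper_fun h \<longleftrightarrow> (\<forall>x. h x \<noteq> -\<infinity>) \<and> eff_dom h \<noteq> {}"

definition lower_semicont :: "('v::topological_space \<Rightarrow> ereal) \<Rightarrow> bool" where
  "lower_semicont h \<longleftrightarrow> (\<forall>x. h x \<le> Liminf (at x) h)"

definition strictly_convex :: "('v::real_vector \<Rightarrow> ereal) \<Rightarrow> bool" where
  "strictly_convex h \<longleftrightarrow>
     (\<forall>x\<in>eff_dom h. \<forall>x'\<in>eff_dom h. \<forall>t\<in>{0<..<1::real}. x \<noteq> x' \<longrightarrow>
        h ((1 - t) *\<^sub>R x + t *\<^sub>R x') < ereal (1 - t) * h x + ereal t * h x')"

definition subdiff :: "('v::real_normed_vector \<Rightarrow> ereal) \<Rightarrow> 'v \<Rightarrow> ('v \<Rightarrow>\<^sub>L real) set" where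
  "subdiff h x = {y. x \<in> eff_dom h \<and> (\<forall>x'. h x' \<ge> h x + ereal (blinfun_apply y (x' - x)))}"

definition prox_dom :: "('v::real_normed_vector \<Rightarrow> ereal) \<Rightarrow> 'v set" where
  "prox_dom h = {x. subdiff h x \<noteq> {}}"

text \<open>In what follows \<open>Dh\<close> stands for the fixed continuous selection \<open>\<nabla>h\<close> of the
  subdifferential of \<open>h\<close>; only its values on \<open>prox_dom h\<close> matter.\<close>

definition strongly_convex_on ::
  "real \<Rightarrow> ('v::real_normed_vector \<Rightarrow> ereal) \<Rightarrow> ('v \<Rightarrow> 'v \<Rightarrow>\<^sub>L real) \<Rightarrow> 'v set \<Rightarrow> bool" where
  "strongly_convex_on \<kappa> h Dh U \<longleftrightarrow>
     (\<forall>x \<in> U \<inter> prox_dom h. \<forall>x'\<in>U.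
        h x' \<ge> h x + ereal (blinfun_apply (Dh x) (x' - x)) + ereal (\<kappa> / 2 * (norm (x' - x))\<^sup>2))"

definition bregman_regularizer ::
  "'v::real_normed_vector set \<Rightarrow> ('v \<Rightarrow> ereal) \<Rightarrow> ('v \<Rightarrow> 'v \<Rightarrow>\<^sub>L real) \<Rightarrow> bool" where
  "bregman_regularizer X h Dh \<longleftrightarrow>
     proper_fun h \<and> lower_semicont h \<and> strictly_convex h \<and>
     eff_dom h = X \<and>
     continuous_on (prox_dom h) Dh \<and> (\<forall>x\<in>prox_dom h. Dh x \<in> subdiff h x) \<and>
     (\<forall>C. compact C \<and> C \<subseteq> eff_dom h \<longrightarrow> (\<exists>\<kappa>>0. strongly_convex_on \<kappa> h Dh C))"

text \<open>Meaningful for \<open>p \<in> eff_dom h\<close> and \<open>x \<in> prox_dom h\<close>, where both values of \<open>h\<close> are finite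
  when \<open>h\<close> is proper.\<close>

definition bregman_div ::
  "('v::real_normed_vector \<Rightarrow> ereal) \<Rightarrow> ('v \<Rightarrow> 'v \<Rightarrow>\<^sub>L real) \<Rightarrow> 'v \<Rightarrow> 'v \<Rightarrow> real" where
  "bregman_div h Dh p x =
     real_of_ereal (h p) - real_of_ereal (h x) - blinfun_apply (Dh x) (p - x)"

definition prox_objective ::
  "('v::real_normed_vector \<Rightarrow> ereal) \<Rightarrow> ('v \<Rightarrow> 'v \<Rightarrow>\<^sub>L real) \<Rightarrow> 'v \<Rightarrow> ('v \<Rightarrow>\<^sub>L real) \<Rightarrow> 'v \<Rightarrow> real" where
  "prox_objective h Dh x y x' = blinfun_apply y (x - x') + bregman_div h Dh x' x"

definition prox_map ::
  "'v::real_normed_vector set \<Rightarrow> ('v \<Rightarrow> ereal) \<Rightarrow> ('v \<Rightarrow> 'v \<Rightarrow>\<^sub>L real) \<Rightarrow> 'v \<Rightarrow> ('v \<Rightarrow>\<^sub>L real) \<Rightarrow> 'v" where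
  "prox_map X h Dh x y = arg_min (prox_objective h Dh x y) (\<lambda>x'. x' \<in> X)"

definition prox_well_defined ::
  "'v::real_normed_vector set \<Rightarrow> ('v \<Rightarrow> ereal) \<Rightarrow> ('v \<Rightarrow> 'v \<Rightarrow>\<^sub>L real) \<Rightarrow> 'v \<Rightarrow> ('v \<Rightarrow>\<^sub>L real) \<Rightarrow> bool" where
  "prox_well_defined X h Dh x y \<longleftrightarrow> (\<exists>!z. is_arg_min (prox_objective h Dh x y) (\<lambda>x'. x' \<in> X) z)"

text \<open>The filter \<open>at p within prox_dom h\<close> omits \<open>p\<close>, so the quotient has a positive denominator.
  If no exponent in \<open>[0,1]\<close> is admissible, the (real) infimum is unspecified, but then
  \<open>legendre_tight\<close> is false.\<close>

definition legendre_exponents ::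
  "('v::real_normed_vector \<Rightarrow> ereal) \<Rightarrow> ('v \<Rightarrow> 'v \<Rightarrow>\<^sub>L real) \<Rightarrow> 'v \<Rightarrow> real set" where
  "legendre_exponents h Dh p =
     {\<beta>\<in>{0..1}. Limsup (at p within prox_dom h)
        (\<lambda>x. ereal (sqrt (bregman_div h Dh p x) / norm (x - p) powr (1 - \<beta>))) < \<infinity>}"

definition legendre_exponent ::
  "('v::real_normed_vector \<Rightarrow> ereal) \<Rightarrow> ('v \<Rightarrow> 'v \<Rightarrow>\<^sub>L real) \<Rightarrow> 'v \<Rightarrow> real" where
  "legendre_exponent h Dh p = Inf (legendre_exponents h Dh p)"

definition legendre_tight ::
  "('v::real_normed_vector \<Rightarrow> ereal) \<Rightarrow> ('v \<Rightarrow> 'v \<Rightarrow>\<^sub>L real) \<Rightarrow> 'v \<Rightarrow> bool" where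
  "legendre_tight h Dh p \<longleftrightarrow> legendre_exponent h Dh p \<in> legendre_exponents h Dh p"

text \<open>Here \<open>x t\<close> is the base state \<open>x\<^bsub>t\<^esub>\<close> for \<open>t \<ge> 1\<close> (the value \<open>x 0\<close> is irrelevant), and \<open>xh t\<close> is
  the leading state \<open>x\<^bsub>t+1/2\<^esub>\<close> for \<open>t \<ge> 0\<close>, so that \<open>xh (t - 1)\<close> is \<open>x\<^bsub>t-1/2\<^esub>\<close>.\<close>

definition bpm_signal ::
  "('v::real_normed_vector \<Rightarrow> 'v \<Rightarrow>\<^sub>L real) \<Rightarrow> real \<Rightarrow> real \<Rightarrow> (nat \<Rightarrow> 'v) \<Rightarrow> (nat \<Rightarrow> 'v) \<Rightarrow> nat \<Rightarrow> 'v \<Rightarrow>\<^sub>L real" where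
  "bpm_signal g la lb x xh t = la *\<^sub>R g (x t) + lb *\<^sub>R g (xh (t - 1))"

definition bpm ::
  "'v::real_normed_vector set \<Rightarrow> ('v \<Rightarrow> ereal) \<Rightarrow> ('v \<Rightarrow> 'v \<Rightarrow>\<^sub>L real) \<Rightarrow> ('v \<Rightarrow> 'v \<Rightarrow>\<^sub>L real)
    \<Rightarrow> real \<Rightarrow> real \<Rightarrow> (nat \<Rightarrow> real) \<Rightarrow> (nat \<Rightarrow> 'v) \<Rightarrow> (nat \<Rightarrow> 'v) \<Rightarrow> bool" where
  "bpm X h Dh g la lb \<gamma> x xh \<longleftrightarrow>
     x 1 \<in> prox_dom h \<and> xh 0 = x 1 \<and>
     (\<forall>t\<ge>1.
        prox_well_defined X h Dh (x t) (- (\<gamma> t *\<^sub>R bpm_signal g la lb x xh t)) \<and>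
        xh t = prox_map X h Dh (x t) (- (\<gamma> t *\<^sub>R bpm_signal g la lb x xh t)) \<and>
        prox_well_defined X h Dh (x t) (- (\<gamma> t *\<^sub>R g (xh t))) \<and>
        x (t + 1) = prox_map X h Dh (x t) (- (\<gamma> t *\<^sub>R g (xh t))))"

text \<open>The constant \<open>\<rho>\<close>, as a function of \<open>\<beta>\<close>, \<open>K\<close> and the initial divergence \<open>D\<^sub>1\<close>. The case
  distinction is needed because \<open>0 powr a = 0\<close> also for negative \<open>a\<close>.\<close>

definition rate_const :: "real \<Rightarrow> real \<Rightarrow> real \<Rightarrow> real" where
  "rate_const \<beta> K D\<^sub>1 =
     (if D\<^sub>1 = 0 then 0
      else \<beta> / (1 - \<beta>) *
           inverse (max (2 * K powr (1 / (1 - \<beta>)) * D\<^sub>1 powr (- (\<beta> / (1 - \<beta>))))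
                        (2 powr (\<beta> / (1 - \<beta>)))))"

end

theory Submission
  imports Defs
begin

text \<open>
  The Lyapunov function is the energy
  \<open>E\<^sub>t = D(p, x\<^sub>t) + (norm (x\<^sub>t - x\<^bsub>t-1/2\<^esub>))\<^sup>2 / 4\<close>, where \<open>p\<close> is the solution. Adding the prox inequalities
  of the two half-steps and using the variational inequality at both new points, every value of \<open>g\<close>
  can be replaced by its difference to \<open>g p\<close>; strong monotonicity and strong convexity then give
  \<open>E\<^bsub>t+1\<^esub> \<le> E\<^sub>t - \<gamma>\<mu> (norm (x\<^sub>t - p))\<^sup>2 / 4 - \<gamma>\<mu> (norm (x\<^sub>t - x\<^bsub>t-1/2\<^esub>))\<^sup>2 / 4\<close>. In particular the
  iterates never leave the region where the local hypotheses hold, and the growth bound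
  \<open>D(p, x) \<le> K/2 (norm (x - p)) powr (2 (1 - \<beta>))\<close> turns this into a recursion
  \<open>E\<^bsub>t+1\<^esub> \<le> E\<^sub>t - c E\<^sub>t powr (1 / (1 - \<beta>))\<close>, which has the stated decay.

  Since \<open>\<nabla>h x\<close> need not be the subgradient that the prox step produces at \<open>x\<close>, one also needs that
  the continuous selection dominates every other subgradient in directions pointing into \<open>X\<close>.
\<close>

section \<open>Compactness in finite-dimensional normed spaces\<close>

text \<open>Outside a closed subspace, \<open>a\<close> has positive distance \<open>d\<close> from
  it; dividing by \<open>c\<close> reduces every coefficient to this case. The result is a bound on
  the \<open>a\<close>-coordinate by the norm, obtained without comparing norms.\<close>

lemma norm_span_insert_lower:
  fixes a :: "'v::real_normed_vector"
  assumes "closed (span S)" "a \<notin> span S"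
  shows "\<exists>d>0. \<forall>c. \<forall>u\<in>span S. d * \<bar>c\<bar> \<le> norm (c *\<^sub>R a + u)"
proof -
  obtain d where d: "d > 0" "ball a d \<subseteq> - span S"
    using assms openE[of "- span S" a] by blast
  have d: "d > 0" "\<And>y. y \<in> span S \<Longrightarrow> d \<le> dist a y"
    using d by (auto simp: subset_iff not_less)
  have "d * \<bar>c\<bar> \<le> norm (c *\<^sub>R a + u)" if u: "u \<in> span S" for c u
  proof (cases "c = 0")
    case False
    have "(- 1 / c) *\<^sub>R u \<in> span S" using u by (rule span_scale)
    from d(2)[OF this] have "d \<le> norm (a + (1 / c) *\<^sub>R u)" by (simp add: dist_norm)
    then have "d * \<bar>c\<bar> \<le> norm (a + (1 / c) *\<^sub>R u) * \<bar>c\<bar>" by (rule mult_right_mono) simp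
    also have "\<dots> = norm (c *\<^sub>R (a + (1 / c) *\<^sub>R u))" by (simp add: mult.commute)
    also have "\<dots> = norm (c *\<^sub>R a + u)" using False by (simp add: scaleR_add_right)
    finally show ?thesis .
  qed simp
  then show ?thesis using d(1) by blast
qed

text \<open>A convergent sequence is bounded, and all its subsequences share its limit. This lets an
  induction hypothesis about subsequences double as closedness of the span.\<close>

lemma closed_if_bounded_subseq:
  fixes V :: "'v::real_normed_vector set"
  assumes "\<And>s :: nat \<Rightarrow> 'v. range s \<subseteq> V \<Longrightarrow> bounded (range s) \<Longrightarrow> \<exists>l\<in>V. \<exists>r. strict_mono r \<and> (s \<circ> r) \<longlonglongrightarrow> l"
  shows "closed V"
  unfolding closed_sequential_limits
proof (intro allI impI, elim conjE)
  fix s :: "nat \<Rightarrow> 'v" and l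
  assume s: "\<forall>n. s n \<in> V" "s \<longlonglongrightarrow> l"
  have "bounded (range s)" using s(2) by (meson convergent_imp_bounded)
  then obtain l' r where "l' \<in> V" "strict_mono r" "(s \<circ> r) \<longlonglongrightarrow> l'" using assms[of s] s(1) by blast
  then show "l \<in> V" using LIMSEQ_subseq_LIMSEQ[OF s(2)] LIMSEQ_unique by metis
qed

text \<open>Bolzano-Weierstrass by induction on the spanning set. Since \<open>span S\<close> is
  closed by the induction hypothesis, the coefficients along \<open>a\<close> are bounded; one
  subsequence makes them converge, a further one makes the remainders in \<open>span S\<close>
  converge.\<close>

lemma bounded_subseq_finite_span:
  fixes s :: "nat \<Rightarrow> 'v::real_normed_vector"
  assumes "finite S" "range s \<subseteq> span S" "bounded (range s)"
  shows "\<exists>l\<in>span S. \<exists>r. strict_mono r \<and> (s \<circ> r) \<longlonglongrightarrow> l"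
  using assms
proof (induction S arbitrary: s rule: finite_induct)
  case empty
  then have "s n = 0" for n by auto
  then have "(s \<circ> id) \<longlonglongrightarrow> 0" by (simp add: o_def)
  then show ?case using strict_mono_id by (metis span_zero)
next
  case (insert a S)
  have closed: "closed (span S)" using insert.IH by (rule closed_if_bounded_subseq)
  show ?case
  proof (cases "a \<in> span S")
    case True
    then show ?thesis using insert.IH[of s] insert.prems by (simp add: span_redundant)
  next
    case False
    then obtain d where d: "d > 0" "\<And>c u. u \<in> span S \<Longrightarrow> d * \<bar>c\<bar> \<le> norm (c *\<^sub>R a + u)"
      using norm_span_insert_lower[OF closed] by blast
    have "\<forall>n. \<exists>c. s n - c *\<^sub>R a \<in> span S"
      using insert.prems(1) by (metis range_subsetD span_breakdown_eq)
    then obtain c where c: "\<And>n. s n - c n *\<^sub>R a \<in> span S" by metis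
    obtain M where M: "\<And>n. norm (s n) \<le> M" using insert.prems(2) by (auto simp: bounded_iff)
    have cM: "\<bar>c n\<bar> \<le> M / d" for n
      using d(2)[OF c[of n], of "c n"] M[of n] d(1) by (simp add: field_simps)
    then have "bounded (range c)" by (auto simp: bounded_iff)
    then obtain c0 r where r: "strict_mono r" "(c \<circ> r) \<longlonglongrightarrow> c0"
      using bounded_imp_convergent_subsequence by blast
    define u where "u n = s (r n) - c (r n) *\<^sub>R a" for n
    have "norm (u n) \<le> M + M / d * norm a" for n
      unfolding u_def using M[of "r n"] cM[of "r n"]
      by (smt (verit) norm_triangle_ineq4 norm_scaleR mult_right_mono norm_ge_zero)
    then have "bounded (range u)" by (auto simp: bounded_iff)
    moreover have "range u \<subseteq> span S" using c by (auto simp: u_def)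
    ultimately obtain l r' where r': "l \<in> span S" "strict_mono r'" "(u \<circ> r') \<longlonglongrightarrow> l"
      using insert.IH by blast
    have "(\<lambda>n. u (r' n) + c (r (r' n)) *\<^sub>R a) \<longlonglongrightarrow> l + c0 *\<^sub>R a"
      using r'(3) LIMSEQ_subseq_LIMSEQ[OF r(2) r'(2)]
      by (intro tendsto_intros) (auto simp: o_def)
    then have "(s \<circ> (r \<circ> r')) \<longlonglongrightarrow> l + c0 *\<^sub>R a" by (simp add: u_def o_def)
    moreover have "strict_mono (r \<circ> r')" using r(1) r'(2) by (rule strict_mono_o)
    moreover have "l + c0 *\<^sub>R a \<in> span (insert a S)"
      using r'(1) by (metis add_diff_cancel_right' span_breakdown_eq)
    ultimately show ?thesis by blast
  qed
qed

lemma closed_finite_span: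
  fixes S :: "'v::real_normed_vector set"
  assumes "finite S"
  shows "closed (span S)"
  using bounded_subseq_finite_span[OF assms] by (rule closed_if_bounded_subseq)

lemma compact_cball_finite_span:
  fixes w :: "'v::real_normed_vector"
  assumes "finite S" "span S = (UNIV :: 'v set)"
  shows "compact (cball w r)"
  unfolding compact_def
proof (intro allI impI)
  fix s :: "nat \<Rightarrow> 'v" assume s: "\<forall>n. s n \<in> cball w r"
  then have "bounded (range s)" by (meson bounded_cball bounded_subset image_subsetI)
  then obtain l r' where l: "strict_mono r'" "(s \<circ> r') \<longlonglongrightarrow> l"
    using bounded_subseq_finite_span[OF assms(1), of s] assms(2) by auto
  moreover have "l \<in> cball w r"
    using closed_sequentially[OF closed_cball _ l(2)] s by simp
  ultimately show "\<exists>l\<in>cball w r. \<exists>r. strict_mono r \<and> (s \<circ> r) \<longlonglongrightarrow> l" by blast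
qed

text \<open>Each basis vector keeps a positive distance from the closed span of the others, so its
  coordinate functional is continuous. These functionals supply a smooth substitute for the squared
  norm.\<close>

lemma bounded_coordinates:
  assumes "finite S" "span S = (UNIV :: 'v::real_normed_vector set)"
  shows "\<exists>(I :: 'v set) (f :: 'v \<Rightarrow> 'v \<Rightarrow>\<^sub>L real). finite I \<and> (\<forall>v. v = (\<Sum>b\<in>I. f b v *\<^sub>R b))"
proof -
  obtain I where I: "I \<subseteq> S" "independent I" "S \<subseteq> span I"
    using maximal_independent_subset by blast
  have fin: "finite I" using I(1) assms(1) by (rule finite_subset)
  have spI: "span I = UNIV" using I(3) assms(2) by (metis UNIV_eq_I span_minimal subspace_span top.extremum_unique)
  define f where "f b v = representation I v b" for b v
  have sum: "v = (\<Sum>b\<in>I. f b v *\<^sub>R b)" for v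
    unfolding f_def using sum_representation_eq[OF I(2) _ fin, of v] spI by simp
  have "bounded_linear (f b)" if b: "b \<in> I" for b
  proof -
    have "b \<notin> span (I - {b})" using I(2) b by (simp add: dependent_def)
    then obtain d where d: "d > 0" "\<And>c u. u \<in> span (I - {b}) \<Longrightarrow> d * \<bar>c\<bar> \<le> norm (c *\<^sub>R b + u)"
      using norm_span_insert_lower[OF closed_finite_span[of "I - {b}"]] fin by blast
    have "\<bar>f b v\<bar> \<le> norm v * (1 / d)" for v
    proof -
      have u: "(\<Sum>b'\<in>I - {b}. f b' v *\<^sub>R b') \<in> span (I - {b})"
        by (intro span_sum span_scale span_base)
      have "v = f b v *\<^sub>R b + (\<Sum>b'\<in>I - {b}. f b' v *\<^sub>R b')"
        using sum[of v] sum.remove[OF fin b, of "\<lambda>b. f b v *\<^sub>R b"] by simp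
      then have "d * \<bar>f b v\<bar> \<le> norm v" using d(2)[OF u, of "f b v"] by simp
      then show ?thesis using d(1) by (simp add: field_simps)
    qed
    moreover have "linear (f b)"
      unfolding f_def using I(2) spI
      by (intro linearI) (simp_all add: representation_add representation_scale)
    ultimately show ?thesis
      by (intro bounded_linear_intro[where K = "1 / d"]) (simp_all add: linear_add linear_scale)
  qed
  then have "v = (\<Sum>b\<in>I. Blinfun (f b) v *\<^sub>R b)" for v
    using sum[of v] by (simp add: bounded_linear_Blinfun_apply cong: sum.cong)
  then show ?thesis using fin by (intro exI[of _ I] exI[of _ "\<lambda>b. Blinfun (f b)"]) blast
qed

text \<open>Without a minimiser, every \<open>x\<close> has a strictly better point
  \<open>k x\<close>, and \<open>F\<close> exceeds \<open>F (k x)\<close> on a neighbourhood of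
  \<open>x\<close>. In a finite subcover, the smallest of the values \<open>F (k x)\<close> is
  beaten at the centre of the set containing that \<open>k x\<close>.\<close>

lemma lsc_attains_min:
  fixes F :: "'a::topological_space \<Rightarrow> real"
  assumes "compact C" "C \<noteq> {}"
    and lsc: "\<And>x c. x \<in> C \<Longrightarrow> c < F x \<Longrightarrow> \<exists>W. open W \<and> x \<in> W \<and> (\<forall>y\<in>W \<inter> C. c < F y)"
  shows "\<exists>z\<in>C. \<forall>y\<in>C. F z \<le> F y"
proof (rule ccontr)
  assume "\<not> ?thesis"
  then have "\<forall>x\<in>C. \<exists>y\<in>C. F y < F x" by force
  then obtain k where k: "\<And>x. x \<in> C \<Longrightarrow> k x \<in> C \<and> F (k x) < F x" by metis
  then have "\<forall>x\<in>C. \<exists>W. open W \<and> x \<in> W \<and> (\<forall>y\<in>W \<inter> C. F (k x) < F y)" using lsc by blast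
  from bchoice[OF this]
  obtain W where W: "\<And>x. x \<in> C \<Longrightarrow> open (W x) \<and> x \<in> W x \<and> (\<forall>y\<in>W x \<inter> C. F (k x) < F y)"
    by blast
  have op: "\<And>x. x \<in> C \<Longrightarrow> open (W x)" and cover: "C \<subseteq> (\<Union>x\<in>C. W x)" using W by auto
  obtain T where T: "T \<subseteq> C" "finite T" "C \<subseteq> (\<Union>x\<in>T. W x)"
    by (rule compactE_image[OF assms(1) op cover])
  then have "T \<noteq> {}" using assms(2) by auto
  then obtain x where x: "x \<in> T" "\<And>y. y \<in> T \<Longrightarrow> F (k x) \<le> F (k y)"
    using ex_is_arg_min_if_finite[OF T(2), of "F \<circ> k"] by (force simp: is_arg_min_def not_less)
  have "k x \<in> C" using k T(1) x(1) by blast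
  then obtain y where "y \<in> T" "k x \<in> W y" using T(3) by blast
  then have "F (k y) < F (k x)" using W[of y] T(1) \<open>k x \<in> C\<close> by blast
  then show False using x(2)[OF \<open>y \<in> T\<close>] by simp
qed

section \<open>Two inequalities for real powers\<close>

text \<open>Midpoint convexity of the power function. It is applied to positive arguments, so
  vanishing summands are split off.\<close>

lemma powr_add_le:
  fixes a b \<alpha> :: real
  assumes "0 \<le> a" "0 \<le> b" "0 \<le> \<alpha>"
  shows "(a + b) powr (1 + \<alpha>) \<le> 2 powr \<alpha> * (a powr (1 + \<alpha>) + b powr (1 + \<alpha>))"
proof (cases "a = 0 \<or> b = 0")
  case True
  have "1 \<le> (2::real) powr \<alpha>" using assms(3) by (simp add: ge_one_powr_ge_zero)
  then have "c \<le> 2 powr \<alpha> * c" if "0 \<le> c" for c :: real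
    using mult_right_mono[of 1 "2 powr \<alpha>" c] that by simp
  then show ?thesis using True by auto
next
  case False
  then have ab: "0 < a" "0 < b" using assms by auto
  have "((1 - 1/2) *\<^sub>R a + (1/2) *\<^sub>R b) powr (1 + \<alpha>) \<le> (1 - 1/2) * a powr (1 + \<alpha>) + 1/2 * b powr (1 + \<alpha>)"
    using assms(3) ab by (intro convex_onD[OF powr_convex]) auto
  moreover have "(1 - 1/2) *\<^sub>R a + (1/2) *\<^sub>R b = (a + b) / 2" by (simp add: field_simps)
  ultimately have "((a + b) / 2) powr (1 + \<alpha>) \<le> (1 - 1/2) * a powr (1 + \<alpha>) + 1/2 * b powr (1 + \<alpha>)"
    by metis
  moreover have "((a + b) / 2) powr (1 + \<alpha>) = (a + b) powr (1 + \<alpha>) / (2 * 2 powr \<alpha>)"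
    using ab by (simp add: powr_divide powr_add)
  ultimately show ?thesis by (simp add: field_simps)
qed

text \<open>
  The negative power \<open>u powr -\<alpha>\<close> grows by at least \<open>\<alpha> * m * u 0 powr -\<alpha>\<close> in every step, because
  \<open>(1 - y) powr -\<alpha> \<ge> 1 + \<alpha> * y\<close>.
\<close>

lemma powr_recursion_decay:
  fixes u :: "nat \<Rightarrow> real"
  assumes \<alpha>: "0 < \<alpha>" and m: "0 \<le> m" and u0: "0 < u 0" and nonneg: "\<And>n. 0 \<le> u n"
    and rec: "\<And>n. u (Suc n) \<le> u n - m * u 0 powr - \<alpha> * u n powr (1 + \<alpha>)"
  shows "u n \<le> u 0 * (1 + \<alpha> * m * real n) powr (- (1 / \<alpha>))"
proof -
  \<comment> \<open>Positivity of the later value is enough: it passes to \<open>u n\<close> by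
    monotonicity and forces \<open>y < 1\<close>, so all negative powers below have positive
    bases.\<close>
  have step: "0 < u n \<and> u n powr - \<alpha> + \<alpha> * (m * u 0 powr - \<alpha>) \<le> u (Suc n) powr - \<alpha>"
    if pos: "0 < u (Suc n)" for n
  proof -
    define c where "c = m * u 0 powr - \<alpha>"
    have c: "0 \<le> c" using m by (simp add: c_def)
    have "u (Suc n) \<le> u n" using rec[of n] c by (smt (verit) c_def mult_nonneg_nonneg powr_ge_zero)
    then have un: "0 < u n" using pos by simp
    define y where "y = c * u n powr \<alpha>"
    have le: "u (Suc n) \<le> u n * (1 - y)"
      using rec[of n] un by (simp add: y_def c_def powr_add algebra_simps)
    then have y: "0 < 1 - y" using pos un by (smt (verit) mult_nonneg_nonpos)
    have "u n powr - \<alpha> + \<alpha> * c = u n powr - \<alpha> * (1 + \<alpha> * y)"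
      using un by (simp add: y_def distrib_left powr_minus)
    also have "\<dots> \<le> u n powr - \<alpha> * (1 - y) powr - \<alpha>"
    proof (rule mult_left_mono)
      \<comment> \<open>The Bernoulli-type bound follows from \<open>1 + w \<le> exp w\<close> and
        \<open>ln (1 - y) \<le> - y\<close>.\<close>
      have "1 + \<alpha> * y \<le> exp (\<alpha> * y)" by (rule exp_ge_add_one_self)
      also have "\<dots> \<le> exp (- \<alpha> * ln (1 - y))"
        using ln_le_minus_one[OF y] \<alpha> mult_left_mono[of "ln (1 - y)" "- y" \<alpha>] by simp
      also have "\<dots> = (1 - y) powr - \<alpha>" using y by (simp add: powr_def)
      finally show "1 + \<alpha> * y \<le> (1 - y) powr - \<alpha>" .
    qed simp
    also have "\<dots> = (u n * (1 - y)) powr - \<alpha>" using un y by (simp add: powr_mult)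
    also have "\<dots> \<le> u (Suc n) powr - \<alpha>" using le pos \<alpha> by (intro powr_mono2') auto
    finally show ?thesis using un by (simp add: c_def)
  qed
  have inv: "u 0 powr - \<alpha> * (1 + \<alpha> * m * real n) \<le> u n powr - \<alpha>" if "0 < u n" for n
    using that
  proof (induction n)
    case (Suc n)
    then show ?case using step[OF Suc.prems] by (simp add: algebra_simps)
  qed simp
  show ?thesis
  proof (cases "u n = 0")
    case True
    then show ?thesis using u0 by simp
  next
    case False
    then have un: "0 < u n" using nonneg[of n] by simp
    have q: "0 < 1 + \<alpha> * m * real n" using \<alpha> m by (simp add: add_pos_nonneg)
    have "u n = (u n powr - \<alpha>) powr (- (1 / \<alpha>))" using un \<alpha> by (simp add: powr_powr)
    also have "\<dots> \<le> (u 0 powr - \<alpha> * (1 + \<alpha> * m * real n)) powr (- (1 / \<alpha>))"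
      using inv[OF un] u0 q \<alpha> by (intro powr_mono2') auto
    also have "\<dots> = u 0 * (1 + \<alpha> * m * real n) powr (- (1 / \<alpha>))"
      using u0 q \<alpha> by (simp add: powr_mult powr_powr)
    finally show ?thesis .
  qed
qed

section \<open>Subgradients and the prox inequality\<close>

text \<open>Finite dimension is expressed by a finite spanning set, which leaves the norm arbitrary
  instead of tying it to an inner product.\<close>

locale bregman =
  fixes X :: "'v::real_normed_vector set" and h :: "'v \<Rightarrow> ereal" and Dh :: "'v \<Rightarrow> 'v \<Rightarrow>\<^sub>L real"
  assumes fin_dim: "\<exists>S :: 'v set. finite S \<and> span S = UNIV"
    and closed_X: "closed X" and convex_X: "convex X"
    and reg: "bregman_regularizer X h Dh"
begin

text \<open>Real arithmetic replaces extended arithmetic on \<open>X\<close>, where \<open>h\<close>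
  is finite; off \<open>X\<close> the value is the default \<open>0\<close> and carries no
  meaning.\<close>

definition hr :: "'v \<Rightarrow> real" where "hr x = real_of_ereal (h x)"

abbreviation D :: "'v \<Rightarrow> 'v \<Rightarrow> real" where "D \<equiv> bregman_div h Dh"

lemma D_eq: "D p x = hr p - hr x - Dh x (p - x)"
  by (simp add: bregman_div_def hr_def)

lemma eff_dom: "eff_dom h = X"
  using reg by (simp add: bregman_regularizer_def)

lemma h_eq_hr:
  assumes "x \<in> X"
  shows "h x = ereal (hr x)"
proof -
  have "h x < \<infinity>" using assms eff_dom by (auto simp: eff_dom_def)
  moreover have "h x \<noteq> - \<infinity>"
    using reg by (simp add: bregman_regularizer_def proper_fun_def)
  ultimately show ?thesis unfolding hr_def by (cases "h x") auto
qed

lemma h_eq_infty: "x \<notin> X \<Longrightarrow> h x = \<infinity>"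
  using eff_dom unfolding eff_dom_def by auto

lemma hr_convex:
  assumes "x \<in> X" "x' \<in> X" "0 < s" "s < 1"
  shows "hr (x + s *\<^sub>R (x' - x)) \<le> hr x + s * (hr x' - hr x)"
proof (cases "x = x'")
  case False
  have eq: "(1 - s) *\<^sub>R x + s *\<^sub>R x' = x + s *\<^sub>R (x' - x)" by (simp add: algebra_simps)
  have inX: "(1 - s) *\<^sub>R x + s *\<^sub>R x' \<in> X" using convexD_alt[OF convex_X assms(1,2)] assms(3,4) by simp
  have "h ((1 - s) *\<^sub>R x + s *\<^sub>R x') < ereal (1 - s) * h x + ereal s * h x'"
    using reg assms False eff_dom unfolding bregman_regularizer_def strictly_convex_def by auto
  then show ?thesis
    using h_eq_hr[OF inX] h_eq_hr[OF assms(1)] h_eq_hr[OF assms(2)]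
    by (simp add: eq algebra_simps)
qed simp

lemma hr_lsc:
  assumes "x \<in> X" "c < hr x"
  shows "\<exists>W. open W \<and> x \<in> W \<and> (\<forall>y\<in>W \<inter> X. c < hr y)"
proof -
  have "ereal c < h x" using h_eq_hr[OF assms(1)] assms(2) by simp
  also have "h x \<le> Liminf (at x) h"
    using reg by (simp add: bregman_regularizer_def lower_semicont_def)
  finally have "eventually (\<lambda>y. ereal c < h y) (at x)" by (rule less_LiminfD)
  then obtain W where W: "open W" "x \<in> W" "\<forall>y\<in>W. y \<noteq> x \<longrightarrow> ereal c < h y"
    unfolding eventually_at_topological by blast
  \<comment> \<open>The limit inferior ignores the point \<open>x\<close> itself, where the
    assumption \<open>c < hr x\<close> takes over.\<close>
  have "c < hr y" if "y \<in> W \<inter> X" for y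
    using W(3) that h_eq_hr[of y] assms(2) by (cases "y = x") auto
  then show ?thesis using W by blast
qed

lemma subdiff_iff: "y \<in> subdiff h x \<longleftrightarrow> x \<in> X \<and> (\<forall>x'\<in>X. hr x + y (x' - x) \<le> hr x')"
proof -
  have "h x' \<ge> h x + ereal (y (x' - x)) \<longleftrightarrow> (x' \<in> X \<longrightarrow> hr x + y (x' - x) \<le> hr x')"
    if "x \<in> X" for x'
    using h_eq_hr[OF that] h_eq_hr[of x'] h_eq_infty[of x'] by (cases "x' \<in> X") simp_all
  then show ?thesis by (auto simp: subdiff_def eff_dom)
qed

lemma prox_dom_subset: "prox_dom h \<subseteq> X"
  unfolding prox_dom_def using subdiff_iff by blast

lemma Dh_subdiff: "x \<in> prox_dom h \<Longrightarrow> Dh x \<in> subdiff h x"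
  using reg by (simp add: bregman_regularizer_def)

lemma D_nonneg: "p \<in> X \<Longrightarrow> x \<in> prox_dom h \<Longrightarrow> 0 \<le> D p x"
  using Dh_subdiff[of x] subdiff_iff[of "Dh x" x] by (auto simp: D_eq)

lemma D_strong:
  assumes "strongly_convex_on \<kappa> h Dh U" "U \<subseteq> X" "x \<in> U \<inter> prox_dom h" "x' \<in> U"
  shows "\<kappa> / 2 * (norm (x' - x))\<^sup>2 \<le> D x' x"
proof -
  have "h x + ereal (Dh x (x' - x)) + ereal (\<kappa> / 2 * (norm (x' - x))\<^sup>2) \<le> h x'"
    using assms unfolding strongly_convex_on_def by blast
  moreover have "x \<in> X" "x' \<in> X" using assms by auto
  ultimately show ?thesis using h_eq_hr by (simp add: D_eq)
qed

text \<open>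
  Near \<open>w\<close> minimise \<open>h\<close> plus a large multiple of a sum of squares of coordinate functionals centred
  at \<open>w\<close>. This penalty is differentiable whatever the norm is, so first-order optimality yields a
  subgradient of \<open>h\<close> at the minimiser, without any separation theorem.
\<close>

lemma prox_dom_dense:
  assumes w: "w \<in> X" and \<epsilon>: "\<epsilon> > 0"
  shows "\<exists>z\<in>prox_dom h. norm (z - w) < \<epsilon>"
proof -
  obtain S :: "'v set" where S: "finite S" "span S = UNIV" using fin_dim by blast
  obtain I :: "'v set" and f :: "'v \<Rightarrow> 'v \<Rightarrow>\<^sub>L real"
    where I: "finite I" and f: "\<And>v. v = (\<Sum>b\<in>I. f b v *\<^sub>R b)"
    using bounded_coordinates[OF S] by blast
  define q where "q v = (\<Sum>b\<in>I. (f b v)\<^sup>2)" for v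
  define M where "M = 1 + (\<Sum>b\<in>I. (norm b)\<^sup>2)"
  have q0: "0 \<le> q v" for v by (simp add: q_def sum_nonneg)
  have M1: "1 \<le> M" by (simp add: M_def sum_nonneg)
  have qM: "(norm v)\<^sup>2 \<le> q v * M" for v
  proof -
    have "norm v \<le> (\<Sum>b\<in>I. \<bar>f b v\<bar> * norm b)"
      by (subst f[of v]) (rule order_trans[OF norm_sum], simp)
    then have "(norm v)\<^sup>2 \<le> (\<Sum>b\<in>I. \<bar>f b v\<bar> * norm b)\<^sup>2" by (rule power_mono) simp
    also have "\<dots> \<le> (\<Sum>b\<in>I. \<bar>f b v\<bar>\<^sup>2) * (\<Sum>b\<in>I. (norm b)\<^sup>2)"
      by (rule Cauchy_Schwarz_ineq_sum)
    also have "\<dots> \<le> q v * M" using q0[of v] by (simp add: q_def M_def algebra_simps)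
    finally show ?thesis .
  qed
  have q_cont: "continuous_on UNIV q"
    unfolding q_def by (intro continuous_intros)
  define C where "C = X \<inter> cball w \<epsilon>"
  have C: "compact C" "w \<in> C"
    unfolding C_def using closed_Int_compact[OF closed_X compact_cball_finite_span[OF S]] w \<epsilon> by auto
  obtain m where m: "\<And>y. y \<in> C \<Longrightarrow> m \<le> hr y"
  proof -
    have "\<exists>z\<in>C. \<forall>y\<in>C. hr z \<le> hr y"
    proof (rule lsc_attains_min[OF C(1)])
      show "C \<noteq> {}" using C(2) by blast
      show "\<exists>W. open W \<and> x \<in> W \<and> (\<forall>y\<in>W \<inter> C. c < hr y)" if x: "x \<in> C" "c < hr x" for x c
        using hr_lsc[of x c] x unfolding C_def by (meson IntD1 IntD2 IntI)
    qed
    then show ?thesis using that by blast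
  qed
  \<comment> \<open>A point of \<open>C\<close> with
    \<open>q (y - w) * M \<ge> \<epsilon>\<^sup>2\<close> pays a penalty of at least
    \<open>hr w - m + 1\<close>, more than \<open>h\<close> can drop below \<open>hr w\<close> on
    \<open>C\<close>. Hence a minimiser lies in the open ball.\<close>
  define R where "R = (hr w - m + 1) * M / \<epsilon>\<^sup>2"
  have R: "R > 0" unfolding R_def using m[OF C(2)] M1 \<epsilon> by (intro divide_pos_pos mult_pos_pos) auto
  define F where "F y = hr y + R * q (y - w)" for y
  have "\<exists>z\<in>C. \<forall>y\<in>C. F z \<le> F y"
  proof (rule lsc_attains_min[OF C(1)])
    show "C \<noteq> {}" using C(2) by blast
    fix x c assume x: "x \<in> C" "c < F x"
    define d where "d = (F x - c) / 2"
    have d: "d > 0" using x(2) by (simp add: d_def)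
    obtain W where W: "open W" "x \<in> W" "\<forall>y\<in>W \<inter> X. hr x - d < hr y"
      using hr_lsc[of x "hr x - d"] x(1) d by (auto simp: C_def)
    have "continuous_on UNIV (\<lambda>y. R * q (y - w))"
      using q_cont by (intro continuous_intros continuous_on_compose2[OF q_cont]) auto
    then have "open {y. R * q (x - w) - d < R * q (y - w)}"
      by (rule open_Collect_less[OF continuous_on_const])
    moreover have "\<forall>y\<in>(W \<inter> {y. R * q (x - w) - d < R * q (y - w)}) \<inter> C. c < F y"
      using W(3) by (force simp: F_def d_def C_def field_simps)
    ultimately show "\<exists>W. open W \<and> x \<in> W \<and> (\<forall>y\<in>W \<inter> C. c < F y)"
      using W(1,2) d by (intro exI[of _ "W \<inter> {y. R * q (x - w) - d < R * q (y - w)}"]) auto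
  qed
  then obtain z where z: "z \<in> C" "\<And>y. y \<in> C \<Longrightarrow> F z \<le> F y" by blast
  have zX: "z \<in> X" using z(1) by (simp add: C_def)
  have "m + R * q (z - w) \<le> hr w"
    using z(2)[OF C(2)] m[OF z(1)] by (simp add: F_def q_def)
  then have "R * q (z - w) < hr w - m + 1" by simp
  then have "(hr w - m + 1) * (M * q (z - w)) < (hr w - m + 1) * \<epsilon>\<^sup>2"
    using \<epsilon> by (simp add: R_def field_simps)
  then have "M * q (z - w) < \<epsilon>\<^sup>2" using m[OF C(2)] by (simp add: mult_less_cancel_left)
  then have "(norm (z - w))\<^sup>2 < \<epsilon>\<^sup>2" using qM[of "z - w"] by (simp add: mult.commute)
  then have near: "norm (z - w) < \<epsilon>" using \<epsilon> by (simp add: power_less_imp_less_base)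
  \<comment> \<open>Minus the gradient at \<open>z\<close> of the penalty
    \<open>R * q (x - w)\<close> in \<open>x\<close>; stationarity makes it the candidate
    subgradient.\<close>
  define y where "y = (\<Sum>b\<in>I. (- 2 * R * f b (z - w)) *\<^sub>R f b)"
  have "hr z + y (x' - z) \<le> hr x'" if x': "x' \<in> X" for x'
  proof -
    let ?v = "x' - z"
    have yv: "y ?v = - 2 * R * (\<Sum>b\<in>I. f b (z - w) * f b ?v)"
      unfolding y_def blinfun.sum_left blinfun.scaleR_left sum_distrib_left by (simp add: mult.assoc)
    have qexp: "q (z - w + s *\<^sub>R ?v) = q (z - w) + 2 * s * (\<Sum>b\<in>I. f b (z - w) * f b ?v) + s\<^sup>2 * q ?v" for s
      unfolding q_def sum_distrib_left sum.distrib[symmetric]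
      by (rule sum.cong)
        (simp_all only: blinfun.add_right blinfun.scaleR_right, simp add: power2_eq_square algebra_simps)
    \<comment> \<open>Minimality is tested along the segment from \<open>z\<close> to
      \<open>x'\<close>. It stays in \<open>C\<close> for small \<open>s\<close> because
      \<open>z\<close> is interior to the ball, and dividing by \<open>s\<close> leaves a remainder
      that vanishes with \<open>s\<close>.\<close>
    have "eventually (\<lambda>s. hr z + y ?v \<le> hr x' + s * (R * q ?v)) (at_right 0)"
    proof -
      have "((\<lambda>s. z + s *\<^sub>R ?v) \<longlongrightarrow> z + 0 *\<^sub>R ?v) (at_right 0)" by (intro tendsto_intros)
      moreover have "open (ball w \<epsilon>)" "z + 0 *\<^sub>R ?v \<in> ball w \<epsilon>"
        using near by (auto simp: dist_norm norm_minus_commute)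
      ultimately have "eventually (\<lambda>s. z + s *\<^sub>R ?v \<in> ball w \<epsilon>) (at_right 0)"
        by (rule topological_tendstoD)
      moreover have "eventually (\<lambda>s::real. 0 < s \<and> s < 1) (at_right 0)"
        using eventually_at_right_real[of 0 "1::real"] by simp
      ultimately show ?thesis
      proof eventually_elim
        case (elim s)
        have "z + s *\<^sub>R ?v \<in> X"
          using convexD_alt[OF convex_X zX x', of s] elim(2) by (simp add: algebra_simps)
        then have "z + s *\<^sub>R ?v \<in> C" using elim(1) by (simp add: C_def)
        from z(2)[OF this]
        have "hr z + R * q (z - w) \<le> hr (z + s *\<^sub>R ?v) + R * q (z - w + s *\<^sub>R ?v)"
          by (simp add: F_def algebra_simps)
        also have "\<dots> \<le> hr z + s * (hr x' - hr z) + R * q (z - w + s *\<^sub>R ?v)"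
          using hr_convex[OF zX x'] elim(2) by simp
        finally have "0 \<le> s * (hr x' - hr z - y ?v + s * (R * q ?v))"
          unfolding qexp yv by (simp add: algebra_simps power2_eq_square)
        then show ?case using elim(2) by (simp add: zero_le_mult_iff)
      qed
    qed
    moreover have "((\<lambda>s. hr x' + s * (R * q ?v)) \<longlongrightarrow> hr x' + 0 * (R * q ?v)) (at_right 0)"
      by (intro tendsto_intros)
    ultimately have "hr z + y ?v \<le> hr x' + 0 * (R * q ?v)"
      by (intro tendsto_lowerbound[where F = "at_right (0::real)"]) auto
    then show ?thesis by simp
  qed
  then have "y \<in> subdiff h z" using zX by (simp add: subdiff_iff)
  then have "z \<in> prox_dom h" by (auto simp: prox_dom_def)
  then show ?thesis using near by blast
qed

text \<open>
  By density there are points \<open>u\<close> of the prox-domain approaching \<open>z\<close> tangentially to \<open>p - z\<close>;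
  monotonicity of the subdifferential gives \<open>y (u - z) \<le> Dh u (u - z)\<close>, and one passes to the limit.
\<close>

lemma subdiff_le_selection:
  assumes z: "z \<in> prox_dom h" and y: "y \<in> subdiff h z" and p: "p \<in> X"
  shows "y (p - z) \<le> Dh z (p - z)"
proof -
  have zX: "z \<in> X" using z prox_dom_subset by blast
  define \<tau> where "\<tau> n = inverse (real (Suc n))" for n
  have \<tau>: "0 < \<tau> n" "\<tau> n \<le> 1" for n by (auto simp: \<tau>_def field_simps)
  have \<tau>0: "\<tau> \<longlonglongrightarrow> 0" unfolding \<tau>_def by (rule LIMSEQ_inverse_real_of_nat)
  \<comment> \<open>The accuracy is \<open>\<tau> n\<close> squared so that the error still tends to
    zero after division by \<open>\<tau> n\<close>; thus the rescaled directions \<open>v n\<close>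
    converge to \<open>p - z\<close>.\<close>
  have "\<exists>u\<in>prox_dom h. norm (u - (z + \<tau> n *\<^sub>R (p - z))) < (\<tau> n)\<^sup>2" for n
  proof (rule prox_dom_dense)
    show "z + \<tau> n *\<^sub>R (p - z) \<in> X"
      using convexD_alt[OF convex_X zX p, of "\<tau> n"] \<tau>[of n] by (simp add: algebra_simps)
    show "0 < (\<tau> n)\<^sup>2" using \<tau>[of n] by simp
  qed
  then obtain u where u: "\<And>n. u n \<in> prox_dom h"
    "\<And>n. norm (u n - (z + \<tau> n *\<^sub>R (p - z))) < (\<tau> n)\<^sup>2" by metis
  define v where "v n = inverse (\<tau> n) *\<^sub>R (u n - z)" for n
  have uv: "u n = z + \<tau> n *\<^sub>R v n" for n using \<tau>[of n] by (simp add: v_def)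
  have "norm (v n - (p - z)) \<le> \<tau> n" for n
  proof -
    have "\<tau> n * norm (v n - (p - z)) = norm (\<tau> n *\<^sub>R (v n - (p - z)))" using \<tau>[of n] by simp
    also have "\<dots> = norm (u n - (z + \<tau> n *\<^sub>R (p - z)))" by (simp add: uv algebra_simps)
    also have "\<dots> \<le> \<tau> n * \<tau> n" using u(2)[of n] by (simp add: power2_eq_square)
    finally show ?thesis using \<tau>[of n] by simp
  qed
  then have "(\<lambda>n. v n - (p - z)) \<longlonglongrightarrow> 0"
    using \<tau>0 by (rule Lim_null_comparison[OF always_eventually, rule_format])
  then have v_lim: "v \<longlonglongrightarrow> p - z" by (simp add: LIM_zero_iff)
  have u_lim: "u \<longlonglongrightarrow> z"
  proof -
    have "(\<lambda>n. z + \<tau> n *\<^sub>R v n) \<longlonglongrightarrow> z + 0 *\<^sub>R (p - z)" using \<tau>0 v_lim by (intro tendsto_intros)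
    then show ?thesis by (simp add: uv[symmetric])
  qed
  have "continuous_on (prox_dom h) Dh" using reg by (simp add: bregman_regularizer_def)
  then have "(\<lambda>n. Dh (u n)) \<longlonglongrightarrow> Dh z"
    using u(1) z u_lim by (rule_tac continuous_on_tendsto_compose) auto
  then have lim: "(\<lambda>n. Dh (u n) (v n)) \<longlonglongrightarrow> Dh z (p - z)"
    using v_lim by (rule blinfun.tendsto)
  have lim': "(\<lambda>n. y (v n)) \<longlonglongrightarrow> y (p - z)" using v_lim by (intro tendsto_intros)
  have "y (v n) \<le> Dh (u n) (v n)" for n
  proof -
    have "hr z + y (u n - z) \<le> hr (u n)"
      using y u(1)[of n] prox_dom_subset by (auto simp: subdiff_iff)
    moreover have "hr (u n) + Dh (u n) (z - u n) \<le> hr z"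
      using Dh_subdiff[OF u(1)[of n]] zX by (auto simp: subdiff_iff)
    ultimately have "y (u n - z) + Dh (u n) (z - u n) \<le> 0" by simp
    then have "\<tau> n * y (v n) \<le> \<tau> n * Dh (u n) (v n)"
      unfolding uv by (simp add: blinfun.scaleR_right blinfun.minus_right)
    then show ?thesis using \<tau>[of n] by simp
  qed
  then show ?thesis by (intro LIMSEQ_le[OF lim' lim]) auto
qed

text \<open>Minimality says that \<open>Dh x + y\<close> is a subgradient at \<open>z\<close>.
  Replacing it by the selection \<open>Dh z\<close> can only increase the pairing with
  \<open>q - z\<close>, which turns the optimality condition into the three-point
  inequality.\<close>

lemma prox_map_ineq:
  assumes x: "x \<in> prox_dom h" and wd: "prox_well_defined X h Dh x y"
    and z: "z = prox_map X h Dh x y"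
  shows "z \<in> prox_dom h" and "q \<in> X \<Longrightarrow> D q z \<le> D q x - D z x - y (q - z)"
proof -
  have "is_arg_min (prox_objective h Dh x y) (\<lambda>x'. x' \<in> X) z"
    unfolding z prox_map_def arg_min_def
    by (rule someI_ex, rule ex1_implies_ex, rule wd[unfolded prox_well_defined_def])
  then have zX: "z \<in> X" and min: "\<And>q. q \<in> X \<Longrightarrow> prox_objective h Dh x y z \<le> prox_objective h Dh x y q"
    by (auto simp: is_arg_min_def not_less)
  have "hr z + (Dh x + y) (q - z) \<le> hr q" if "q \<in> X" for q
    using min[OF that] by (simp add: prox_objective_def D_eq blinfun.add_left blinfun.diff_right)
  then have sd: "Dh x + y \<in> subdiff h z" using zX by (simp add: subdiff_iff)
  then show zp: "z \<in> prox_dom h" by (auto simp: prox_dom_def)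
  show "D q z \<le> D q x - D z x - y (q - z)" if "q \<in> X"
    using subdiff_le_selection[OF zp sd that]
    by (simp add: D_eq blinfun.add_left blinfun.diff_right)
qed

end

section \<open>Energy descent and confinement\<close>

text \<open>
  The bound \<open>31/100\<close> is a rational upper approximation of \<open>1 / (2\<phi>)\<close>.
\<close>

locale bpm_local = bregman X h Dh
  for X :: "'v::real_normed_vector set" and h Dh +
  fixes g :: "'v \<Rightarrow> 'v \<Rightarrow>\<^sub>L real" and p :: 'v and L \<mu> \<gamma> la lb r :: real
  assumes p: "p \<in> X" and vi: "\<And>x. x \<in> X \<Longrightarrow> 0 \<le> g p (x - p)"
    and lip: "\<And>x x'. x \<in> X \<Longrightarrow> x' \<in> X \<Longrightarrow> norm (g x' - g x) \<le> L * norm (x' - x)"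
    and pos: "0 < L" "0 < \<mu>" "0 < \<gamma>" "0 < r"
    and strong_mono: "\<And>x. x \<in> X \<Longrightarrow> norm (x - p) < r \<Longrightarrow> \<mu> * (norm (x - p))\<^sup>2 \<le> (g x - g p) (x - p)"
    and strong_conv: "\<And>x x'. x \<in> prox_dom h \<Longrightarrow> norm (x - p) < r \<Longrightarrow> x' \<in> X \<Longrightarrow> norm (x' - p) < r \<Longrightarrow>
      (norm (x' - x))\<^sup>2 / 2 \<le> D x' x"
    and step: "\<gamma> * L \<le> 31 / 100" "\<gamma> * (1 - la - lb)\<^sup>2 * L\<^sup>2 \<le> \<mu> / 8"
    and la: "0 \<le> la" and lb: "0 \<le> lb" and lalb: "la + lb \<le> 1" "lb > 0 \<Longrightarrow> la + lb = 1"
begin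

text \<open>
  Strong convexity is only local; a point \<open>z\<close> far from \<open>x\<close> is handled by convexity of \<open>D(\<cdot>, x)\<close>
  along the segment from \<open>x\<close> to \<open>z\<close>, so that \<open>D(z, x)\<close> grows at least linearly in the distance.
\<close>

lemma prox_point_near:
  assumes s: "0 < s" "s \<le> r" and x: "x \<in> prox_dom h" "norm (x - p) \<le> s / 4" "D p x < s\<^sup>2 / 64"
    and z: "z \<in> X" "D z x \<le> D p x + c * norm (z - p)" and c: "c \<le> s / 16"
  shows "norm (z - p) < s"
proof -
  have xX: "x \<in> X" using x(1) prox_dom_subset by blast
  have zp: "norm (z - p) \<le> norm (z - x) + norm (x - p)"
    by (rule order_trans[OF _ norm_triangle_ineq]) simp
  have "norm (z - x) < s / 2"
  proof (rule ccontr)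
    assume "\<not> ?thesis"
    then have n: "s / 2 \<le> norm (z - x)" by simp
    define n where "n = norm (z - x)"
    have n0: "0 < n" "s / 2 \<le> n" using n s(1) by (auto simp: n_def)
    \<comment> \<open>This fraction places \<open>w\<close> on the segment at distance
      \<open>s / 4\<close> from \<open>x\<close>, hence within \<open>s / 2\<close> of
      \<open>p\<close>, where strong convexity is available.\<close>
    define \<theta> where "\<theta> = s / 4 / n"
    have \<theta>: "0 < \<theta>" "\<theta> < 1" "\<theta> * n = s / 4" using n0 s(1) by (auto simp: \<theta>_def field_simps)
    define w where "w = x + \<theta> *\<^sub>R (z - x)"
    have wX: "w \<in> X"
      using convexD_alt[OF convex_X xX z(1), of \<theta>] \<theta> by (simp add: w_def algebra_simps)
    have wx: "norm (w - x) = s / 4" using \<theta> by (simp add: w_def n_def)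
    have "norm (w - p) \<le> norm (w - x) + norm (x - p)"
      by (rule order_trans[OF _ norm_triangle_ineq]) simp
    then have "norm (w - p) < r" using wx x(2) s by simp
    moreover have "norm (x - p) < r" using x(2) s by simp
    ultimately have "s\<^sup>2 / 32 \<le> D w x"
      using strong_conv[OF x(1) _ wX] wx by (simp add: power2_eq_square)
    also have "\<dots> \<le> \<theta> * D z x"
    proof -
      have "D w x = hr w - hr x - \<theta> * Dh x (z - x)" by (simp add: D_eq w_def blinfun.scaleR_right)
      moreover have "hr w \<le> hr x + \<theta> * (hr z - hr x)"
        unfolding w_def by (rule hr_convex[OF xX z(1) \<theta>(1,2)])
      ultimately show ?thesis by (simp add: D_eq algebra_simps)
    qed
    finally have "n * (s\<^sup>2 / 32) \<le> n * (\<theta> * D z x)" using n0 by (intro mult_left_mono) auto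
    also have "\<dots> = s / 4 * D z x" using \<theta>(3) by (metis mult.assoc mult.commute)
    finally have "s * (n * s / 8) \<le> s * D z x" by (simp add: power2_eq_square ac_simps)
    then have "n * s / 8 \<le> D z x" using s(1) by simp
    \<comment> \<open>The lower bound has slope \<open>s / 8\<close> in \<open>n\<close>, the upper
      bound only \<open>s / 16\<close>. For \<open>n \<ge> s / 2\<close> the gap
      \<open>n * s / 16\<close> is at least \<open>s\<^sup>2 / 32\<close>, more than
      \<open>D p x + s\<^sup>2 / 64\<close>.\<close>
    also have "\<dots> \<le> D p x + s / 16 * (n + s / 4)"
    proof -
      have "c * norm (z - p) \<le> s / 16 * norm (z - p)" using c by (intro mult_right_mono) auto
      also have "\<dots> \<le> s / 16 * (n + s / 4)"
        using zp x(2) s(1) by (intro mult_left_mono) (auto simp: n_def)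
      finally show ?thesis using z(2) by simp
    qed
    also have "\<dots> = D p x + n * s / 16 + s\<^sup>2 / 64" by (simp add: power2_eq_square field_simps)
    finally have "n * s / 16 \<le> D p x + s\<^sup>2 / 64" by simp
    moreover have "s / 2 * s \<le> n * s" using n0 s(1) by (intro mult_right_mono) auto
    ultimately show False using x(3) by (simp add: power2_eq_square)
  qed
  then show ?thesis using zp x(2) s(1) by simp
qed

text \<open>The vector compares \<open>g z\<close> with the signal after centring all values at
  \<open>g p\<close>. If \<open>lb = 0\<close>, the uncovered fraction \<open>1 - la\<close> of
  \<open>g z - g p\<close> is paid for by the second step-size condition; if \<open>lb > 0\<close>,
  the weights sum to one and only differences to \<open>g x\<close> and \<open>g zm\<close>
  remain.\<close>

lemma signal_error:
  assumes X: "x \<in> X" "z \<in> X" "zm \<in> X"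
  shows "(\<gamma> * norm (g z - g p - la *\<^sub>R (g x - g p) - lb *\<^sub>R (g zm - g p)))\<^sup>2
    \<le> 3 / 2 * (\<gamma> * L)\<^sup>2 * (norm (x - zm))\<^sup>2 + \<gamma> * \<mu> / 4 * (norm (z - p))\<^sup>2 + 3 / 10 * (norm (z - x))\<^sup>2"
    (is "(\<gamma> * ?N)\<^sup>2 \<le> _")
proof -
  have q: "(\<gamma> * L)\<^sup>2 \<le> (31 / 100)\<^sup>2" using step(1) pos by (intro power_mono) auto
  show ?thesis
  proof (cases "lb > 0")
    case False
    then have lb0: "lb = 0" using lb by simp
    have "g z - g p - la *\<^sub>R (g x - g p) - lb *\<^sub>R (g zm - g p)
        = la *\<^sub>R (g z - g x) + (1 - la) *\<^sub>R (g z - g p)"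
      by (simp add: lb0 algebra_simps)
    then have "?N \<le> la * norm (g z - g x) + (1 - la) * norm (g z - g p)"
      using norm_triangle_ineq[of "la *\<^sub>R (g z - g x)" "(1 - la) *\<^sub>R (g z - g p)"] la lalb lb by simp
    also have "\<dots> \<le> la * (L * norm (z - x)) + (1 - la) * (L * norm (z - p))"
      using lip X p la lalb(1) lb by (intro add_mono mult_left_mono) auto
    also have "\<dots> \<le> L * norm (z - x) + (1 - la) * (L * norm (z - p))"
      using mult_right_mono[of la 1 "L * norm (z - x)"] la lalb(1) lb pos by simp
    finally have "\<gamma> * ?N \<le> \<gamma> * (L * norm (z - x) + (1 - la) * (L * norm (z - p)))"
      using pos by (intro mult_left_mono) auto
    also have "\<dots> = \<gamma> * L * norm (z - x) + \<gamma> * (1 - la) * L * norm (z - p)"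
      by (simp add: algebra_simps)
    finally have "\<gamma> * ?N \<le> \<gamma> * L * norm (z - x) + \<gamma> * (1 - la) * L * norm (z - p)" .
    then have "(\<gamma> * ?N)\<^sup>2 \<le> (\<gamma> * L * norm (z - x) + \<gamma> * (1 - la) * L * norm (z - p))\<^sup>2"
      using pos by (intro power_mono) auto
    also have "\<dots> \<le> 2 * (\<gamma> * L * norm (z - x))\<^sup>2 + 2 * (\<gamma> * (1 - la) * L * norm (z - p))\<^sup>2"
      using sum_squares_bound[of "\<gamma> * L * norm (z - x)" "\<gamma> * (1 - la) * L * norm (z - p)"]
      by (simp add: power2_sum)
    also have "\<dots> = 2 * (\<gamma> * L)\<^sup>2 * (norm (z - x))\<^sup>2
        + 2 * \<gamma> * (\<gamma> * (1 - la - lb)\<^sup>2 * L\<^sup>2) * (norm (z - p))\<^sup>2"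
      by (simp add: lb0 power_mult_distrib power2_eq_square)
    also have "\<dots> \<le> 3 / 10 * (norm (z - x))\<^sup>2 + 2 * \<gamma> * (\<mu> / 8) * (norm (z - p))\<^sup>2"
      using q step(2) pos by (intro add_mono mult_right_mono mult_left_mono) (auto simp: power2_eq_square)
    also have "\<dots> \<le> 3 / 2 * (\<gamma> * L)\<^sup>2 * (norm (x - zm))\<^sup>2 + \<gamma> * \<mu> / 4 * (norm (z - p))\<^sup>2
        + 3 / 10 * (norm (z - x))\<^sup>2" by simp
    finally show ?thesis .
  next
    case True
    then have lb1: "lb = 1 - la" using lalb(2) by simp
    have la1: "la \<le> 1" using lb lb1 by simp
    let ?a = "norm (z - x)" and ?b = "norm (z - zm)"
    have "g z - g p - la *\<^sub>R (g x - g p) - lb *\<^sub>R (g zm - g p)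
        = la *\<^sub>R (g z - g x) + (1 - la) *\<^sub>R (g z - g zm)"
      by (simp add: lb1 algebra_simps)
    then have "?N \<le> la * norm (g z - g x) + (1 - la) * norm (g z - g zm)"
      using norm_triangle_ineq[of "la *\<^sub>R (g z - g x)" "(1 - la) *\<^sub>R (g z - g zm)"] la la1 by simp
    also have "\<dots> \<le> la * (L * ?a) + (1 - la) * (L * ?b)"
      using lip X la la1 by (intro add_mono mult_left_mono) auto
    finally have "\<gamma> * ?N \<le> \<gamma> * (la * (L * ?a) + (1 - la) * (L * ?b))"
      using pos by (intro mult_left_mono) auto
    also have "\<dots> = (\<gamma> * L) * (la * ?a + (1 - la) * ?b)" by (simp add: algebra_simps)
    finally have "\<gamma> * ?N \<le> (\<gamma> * L) * (la * ?a + (1 - la) * ?b)" .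
    then have "(\<gamma> * ?N)\<^sup>2 \<le> ((\<gamma> * L) * (la * ?a + (1 - la) * ?b))\<^sup>2"
      using pos by (intro power_mono) auto
    also have "\<dots> = (\<gamma> * L)\<^sup>2 * (la * ?a + (1 - la) * ?b)\<^sup>2" by (simp add: power_mult_distrib)
    also have "\<dots> \<le> (\<gamma> * L)\<^sup>2 * (3 * ?a\<^sup>2 + 3 / 2 * (norm (x - zm))\<^sup>2)"
    proof (rule mult_left_mono)
      \<comment> \<open>Convexity of the square, as the variance of a two-point distribution with
        weights \<open>la\<close> and \<open>1 - la\<close>.\<close>
      have "la * ?a\<^sup>2 + (1 - la) * ?b\<^sup>2 - (la * ?a + (1 - la) * ?b)\<^sup>2 = la * (1 - la) * (?a - ?b)\<^sup>2"
        by (simp add: power2_eq_square algebra_simps)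
      moreover have "0 \<le> la * (1 - la) * (?a - ?b)\<^sup>2" using la la1 by simp
      moreover have "?b\<^sup>2 \<le> 3 * ?a\<^sup>2 + 3 / 2 * (norm (x - zm))\<^sup>2"
      proof -
        have "?b \<le> ?a + norm (x - zm)"
          by (rule order_trans[OF _ norm_triangle_ineq]) simp
        then have "?b\<^sup>2 \<le> (?a + norm (x - zm))\<^sup>2" by (intro power_mono) auto
        \<comment> \<open>Young's inequality for the cross term; it yields the coefficients
          \<open>3 = 1 + 2\<close> and \<open>3 / 2 = 1 + 1 / 2\<close>.\<close>
        moreover have "0 \<le> (2 * ?a - norm (x - zm))\<^sup>2" by simp
        ultimately show ?thesis by (simp add: power2_eq_square algebra_simps)
      qed
      then have "(1 - la) * ?b\<^sup>2 \<le> (1 - la) * (3 * ?a\<^sup>2 + 3 / 2 * (norm (x - zm))\<^sup>2)"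
        using la1 by (intro mult_left_mono) auto
      moreover have "la * ?a\<^sup>2 \<le> la * (3 * ?a\<^sup>2 + 3 / 2 * (norm (x - zm))\<^sup>2)"
        using la by (intro mult_left_mono) auto
      moreover have "la * V + (1 - la) * V = V" for V :: real by (simp add: algebra_simps)
      ultimately show "(la * ?a + (1 - la) * ?b)\<^sup>2 \<le> 3 * ?a\<^sup>2 + 3 / 2 * (norm (x - zm))\<^sup>2"
        by (smt (verit))
    qed simp
    also have "\<dots> \<le> 3 / 2 * (\<gamma> * L)\<^sup>2 * (norm (x - zm))\<^sup>2 + \<gamma> * \<mu> / 4 * (norm (z - p))\<^sup>2 + 3 / 10 * ?a\<^sup>2"
    proof -
      have "(\<gamma> * L)\<^sup>2 * ?a\<^sup>2 \<le> 1 / 10 * ?a\<^sup>2" using q by (intro mult_right_mono) (auto simp: power2_eq_square)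
      moreover have "0 \<le> \<gamma> * \<mu> / 4 * (norm (z - p))\<^sup>2" using pos by simp
      ultimately show ?thesis by (simp add: algebra_simps)
    qed
    finally show ?thesis .
  qed
qed

text \<open>Adding \<open>lead\<close> and \<open>base\<close> cancels \<open>D x' x\<close> and
  leaves \<open>D x' z\<close> and \<open>D z x\<close> as gains. They absorb the signal error, and
  half of the first survives as the memory term of the next energy.\<close>

lemma step_descent:
  assumes x: "x \<in> prox_dom h" "norm (x - p) < r" and zm: "zm \<in> X"
    and z: "z \<in> prox_dom h" "norm (z - p) < r"
    and x': "x' \<in> prox_dom h" "norm (x' - p) < r"
    and lead: "D x' z \<le> D x' x - D z x + \<gamma> * (la *\<^sub>R g x + lb *\<^sub>R g zm) (x' - z)"
    and base: "D p x' \<le> D p x - D x' x + \<gamma> * g z (p - x')"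
  shows "D p x' + (norm (x' - z))\<^sup>2 / 4 \<le> D p x + 3 / 2 * (\<gamma> * L)\<^sup>2 * (norm (x - zm))\<^sup>2
    - 3 / 4 * (\<gamma> * \<mu>) * (norm (z - p))\<^sup>2 - (norm (z - x))\<^sup>2 / 5"
proof -
  have X: "x \<in> X" "z \<in> X" "x' \<in> X" using x z x' prox_dom_subset by auto
  let ?e = "norm (x' - z)"
  let ?V = "g z - g p - la *\<^sub>R (g x - g p) - lb *\<^sub>R (g zm - g p)"
  \<comment> \<open>After centring at \<open>g p\<close>, the leftover is a nonnegative combination
    of the variational inequality at \<open>x'\<close> and at \<open>z\<close>, with weights
    \<open>1 - la - lb\<close> and \<open>la + lb\<close>.\<close>
  have "g z (p - x') + (la *\<^sub>R g x + lb *\<^sub>R g zm) (x' - z)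
    = - (g z - g p) (z - p) - ?V (x' - z) - ((1 - la - lb) * g p (x' - p) + (la + lb) * g p (z - p))"
    by (simp add: blinfun.add_left blinfun.diff_left blinfun.scaleR_left blinfun.diff_right
        blinfun.add_right algebra_simps)
  also have "\<dots> \<le> - \<mu> * (norm (z - p))\<^sup>2 + norm ?V * ?e"
  proof -
    have "0 \<le> (1 - la - lb) * g p (x' - p) + (la + lb) * g p (z - p)"
      using vi X la lb lalb by simp
    moreover have "- ?V (x' - z) \<le> norm ?V * ?e"
      using norm_blinfun[of ?V "x' - z"] by simp
    moreover have "\<mu> * (norm (z - p))\<^sup>2 \<le> (g z - g p) (z - p)" using strong_mono X z by simp
    ultimately show ?thesis by simp
  qed
  finally have "\<gamma> * (g z (p - x') + (la *\<^sub>R g x + lb *\<^sub>R g zm) (x' - z))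
      \<le> \<gamma> * (- \<mu> * (norm (z - p))\<^sup>2 + norm ?V * ?e)"
    using pos by (intro mult_left_mono) auto
  also have "\<dots> = - \<gamma> * \<mu> * (norm (z - p))\<^sup>2 + (\<gamma> * norm ?V) * ?e" by (simp add: algebra_simps)
  \<comment> \<open>Young's inequality is weighted to spend exactly half of the bound
    \<open>?e\<^sup>2 / 2\<close> on \<open>D x' z\<close>.\<close>
  also have "(\<gamma> * norm ?V) * ?e \<le> (\<gamma> * norm ?V)\<^sup>2 + ?e\<^sup>2 / 4"
    using zero_le_power2[of "\<gamma> * norm ?V - ?e / 2"] by (simp add: power2_diff power_divide)
  finally have "\<gamma> * g z (p - x') + \<gamma> * (la *\<^sub>R g x + lb *\<^sub>R g zm) (x' - z)
      \<le> - \<gamma> * \<mu> * (norm (z - p))\<^sup>2 + ((\<gamma> * norm ?V)\<^sup>2 + ?e\<^sup>2 / 4)"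
    by (simp add: distrib_left)
  moreover have "?e\<^sup>2 / 2 \<le> D x' z" "(norm (z - x))\<^sup>2 / 2 \<le> D z x"
    using strong_conv x z x' X by auto
  \<comment> \<open>The final coefficients are \<open>1 - 1 / 4 = 3 / 4\<close> for the monotonicity
    gain and \<open>1 / 2 - 3 / 10 = 1 / 5\<close> for the displacement.\<close>
  ultimately show ?thesis
    using lead base signal_error[OF X(1,2) zm] by simp
qed

text \<open>The share of \<open>g p\<close> in the signal has a favourable sign by the variational
  inequality, and the rest is Lipschitz-small. This gives the linear growth with small slope that
  \<open>prox_point_near\<close> asks for at the leading point.\<close>

lemma signal_le:
  assumes x: "x \<in> X" "norm (x - p) \<le> d" and zm: "zm \<in> X" "norm (zm - p) \<le> d" and z: "z \<in> X"
  shows "(la *\<^sub>R g x + lb *\<^sub>R g zm) (p - z) \<le> L * d * norm (z - p)"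
proof -
  have d: "0 \<le> d" using x(2) norm_ge_zero order_trans by blast
  have le: "(g w - g p) (p - z) \<le> L * d * norm (z - p)" if "w \<in> X" "norm (w - p) \<le> d" for w
  proof -
    have "(g w - g p) (p - z) \<le> norm (g w - g p) * norm (p - z)"
      using norm_blinfun[of "g w - g p" "p - z"] by simp
    also have "\<dots> \<le> L * d * norm (z - p)"
    proof -
      have "norm (g w - g p) \<le> L * d"
        using order_trans[OF lip[OF p that(1)] mult_left_mono[OF that(2)]] pos by simp
      then show ?thesis by (simp add: norm_minus_commute[of p z] mult_right_mono)
    qed
    finally show ?thesis .
  qed
  have "(la *\<^sub>R g x + lb *\<^sub>R g zm) (p - z)
    = la * (g x - g p) (p - z) + lb * (g zm - g p) (p - z) - (la + lb) * g p (z - p)"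
    by (simp add: blinfun.add_left blinfun.diff_left blinfun.scaleR_left blinfun.diff_right algebra_simps)
  also have "\<dots> \<le> la * (L * d * norm (z - p)) + lb * (L * d * norm (z - p)) - 0"
    using le[OF x] le[OF zm] vi[OF z] la lb
    by (intro diff_mono add_mono mult_left_mono mult_nonneg_nonneg) auto
  also have "\<dots> = (la + lb) * (L * d * norm (z - p))" by (simp add: algebra_simps)
  also have "\<dots> \<le> L * d * norm (z - p)"
    using lalb(1) d pos mult_right_mono[of "la + lb" 1 "L * d * norm (z - p)"] by simp
  finally show ?thesis .
qed

context
  fixes x xh :: "nat \<Rightarrow> 'v"
  assumes bpm: "bpm X h Dh g la lb (\<lambda>t. \<gamma>) x xh"
begin

definition E :: "nat \<Rightarrow> real" where "E t = D p (x t) + (norm (x t - xh (t - 1)))\<^sup>2 / 4"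

lemma E_1: "E 1 = D p (x 1)"
  using bpm by (simp add: E_def bpm_def)

lemma lead_point:
  assumes "1 \<le> t" "x t \<in> prox_dom h"
  shows "xh t \<in> prox_dom h"
    and "q \<in> X \<Longrightarrow> D q (xh t) \<le> D q (x t) - D (xh t) (x t)
      + \<gamma> * (la *\<^sub>R g (x t) + lb *\<^sub>R g (xh (t - 1))) (q - xh t)"
proof -
  have "prox_well_defined X h Dh (x t) (- (\<gamma> *\<^sub>R bpm_signal g la lb x xh t))"
    "xh t = prox_map X h Dh (x t) (- (\<gamma> *\<^sub>R bpm_signal g la lb x xh t))"
    using bpm assms(1) unfolding bpm_def by blast+
  note * = prox_map_ineq[OF assms(2) this]
  show "xh t \<in> prox_dom h" by (rule *)
  show "q \<in> X \<Longrightarrow> D q (xh t) \<le> D q (x t) - D (xh t) (x t)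
      + \<gamma> * (la *\<^sub>R g (x t) + lb *\<^sub>R g (xh (t - 1))) (q - xh t)"
    using *(2) by (simp add: bpm_signal_def blinfun.minus_left blinfun.scaleR_left)
qed

lemma base_point:
  assumes "1 \<le> t" "x t \<in> prox_dom h"
  shows "x (Suc t) \<in> prox_dom h"
    and "q \<in> X \<Longrightarrow> D q (x (Suc t)) \<le> D q (x t) - D (x (Suc t)) (x t) + \<gamma> * g (xh t) (q - x (Suc t))"
proof -
  have "prox_well_defined X h Dh (x t) (- (\<gamma> *\<^sub>R g (xh t)))"
    "x (Suc t) = prox_map X h Dh (x t) (- (\<gamma> *\<^sub>R g (xh t)))"
    using bpm assms(1) unfolding bpm_def Suc_eq_plus1 by blast+
  note * = prox_map_ineq[OF assms(2) this]
  show "x (Suc t) \<in> prox_dom h" by (rule *)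
  show "q \<in> X \<Longrightarrow> D q (x (Suc t)) \<le> D q (x t) - D (x (Suc t)) (x t) + \<gamma> * g (xh t) (q - x (Suc t))"
    using *(2) by (simp add: blinfun.minus_left blinfun.scaleR_left)
qed

text \<open>The invariant of the iteration. The distance bound \<open>r\<close> opens the way to
  strong convexity; the energy bound then improves it to \<open>r / 128\<close> for
  \<open>x t\<close> and \<open>r / 64\<close> for the previous leading point.\<close>

definition confined :: "nat \<Rightarrow> bool" where
  "confined t \<longleftrightarrow> x t \<in> prox_dom h \<and> norm (x t - p) < r \<and> xh (t - 1) \<in> X \<and> E t \<le> (r / 256)\<^sup>2"

text \<open>Localisation precedes descent: \<open>prox_point_near\<close> places both new points
  within \<open>r\<close> of \<open>p\<close>, where \<open>step_descent\<close> applies, and the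
  decreasing energy restores the invariant.\<close>

lemma confined_step:
  assumes t: "1 \<le> t" and conf: "confined t"
  shows "confined (Suc t)"
    and "E (Suc t) \<le> D p (x t) + 3 / 2 * (\<gamma> * L)\<^sup>2 * (norm (x t - xh (t - 1)))\<^sup>2
      - 3 / 4 * (\<gamma> * \<mu>) * (norm (xh t - p))\<^sup>2 - (norm (xh t - x t))\<^sup>2 / 5"
    and "E (Suc t) \<le> E t"
proof -
  have x: "x t \<in> prox_dom h" "norm (x t - p) < r" and zm: "xh (t - 1) \<in> X" and E: "E t \<le> (r / 256)\<^sup>2"
    using conf by (auto simp: confined_def)
  have xX: "x t \<in> X" using x(1) prox_dom_subset by blast
  have D0: "0 \<le> D p (x t)" using D_nonneg[OF p x(1)] .
  have Dx: "D p (x t) \<le> (r / 256)\<^sup>2"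
    using E zero_le_power2[of "norm (x t - xh (t - 1))"] unfolding E_def by linarith
  have "(norm (p - x t))\<^sup>2 / 2 \<le> D p (x t)" using strong_conv[OF x p] pos by simp
  then have "(norm (x t - p))\<^sup>2 \<le> 4 * (r / 256)\<^sup>2"
    using Dx zero_le_power2[of "r / 256"] unfolding norm_minus_commute[of p] by linarith
  then have "(norm (x t - p))\<^sup>2 \<le> (r / 128)\<^sup>2" by (simp add: power_divide)
  then have xp: "norm (x t - p) \<le> r / 128" by (rule power2_le_imp_le) (use pos in simp)
  have "(norm (x t - xh (t - 1)))\<^sup>2 \<le> (r / 128)\<^sup>2"
    using E D0 unfolding E_def by (simp add: power_divide)
  then have "norm (x t - xh (t - 1)) \<le> r / 128" by (rule power2_le_imp_le) (use pos in simp)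
  then have zmp: "norm (xh (t - 1) - p) \<le> r / 64"
    using xp norm_triangle_ineq[of "xh (t - 1) - x t" "x t - p"] by (simp add: norm_minus_commute)
  have Ds: "D p (x t) < (r / 8)\<^sup>2 / 64" "D p (x t) < r\<^sup>2 / 64"
  proof -
    have "D p (x t) * 65536 \<le> r\<^sup>2" using Dx by (simp add: power_divide)
    moreover have "0 < r\<^sup>2" using pos(4) by (rule zero_less_power)
    ultimately have "D p (x t) * 4096 < r\<^sup>2" "D p (x t) * 64 < r\<^sup>2" by linarith+
    then show "D p (x t) < (r / 8)\<^sup>2 / 64" "D p (x t) < r\<^sup>2 / 64" by (simp_all add: power_divide)
  qed
  note lead = lead_point[OF t x(1)]
  note base = base_point[OF t x(1)]
  have zX: "xh t \<in> X" and yX: "x (Suc t) \<in> X" using lead(1) base(1) prox_dom_subset by auto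
  have \<gamma>L: "\<gamma> * (L * d * n) \<le> 31 / 100 * d * n" if "0 \<le> d" "0 \<le> n" for d n
    using mult_right_mono[OF step(1), of "d * n"] that by (simp add: algebra_simps)
  \<comment> \<open>The smaller radius \<open>r / 8\<close> matters for the next step: it makes the
    slope there \<open>31 / 100 * (r / 8)\<close>, below the permitted
    \<open>r / 16\<close>.\<close>
  have z8: "norm (xh t - p) < r / 8"
  proof (rule prox_point_near[OF _ _ x(1) _ _ zX])
    have "\<gamma> * (la *\<^sub>R g (x t) + lb *\<^sub>R g (xh (t - 1))) (p - xh t) \<le> \<gamma> * (L * (r / 64) * norm (xh t - p))"
      using signal_le[OF xX _ zm zmp zX] xp pos by (intro mult_left_mono) auto
    also have "\<dots> \<le> 31 / 100 * (r / 64) * norm (xh t - p)" using pos by (intro \<gamma>L) auto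
    finally show "D (xh t) (x t) \<le> D p (x t) + 31 / 100 * (r / 64) * norm (xh t - p)"
      using lead(2)[OF p] D_nonneg[OF p lead(1)] by simp
  qed (use pos xp Ds in auto)
  have yr: "norm (x (Suc t) - p) < r"
  proof (rule prox_point_near[OF _ _ x(1) _ _ yX])
    have "g (xh t) (p - x (Suc t)) = (g (xh t) - g p) (p - x (Suc t)) - g p (x (Suc t) - p)"
      by (simp add: blinfun.diff_left blinfun.diff_right)
    also have "\<dots> \<le> norm (g (xh t) - g p) * norm (p - x (Suc t))"
      using norm_blinfun[of "g (xh t) - g p" "p - x (Suc t)"] vi[OF yX] by simp
    also have "\<dots> \<le> L * (r / 8) * norm (x (Suc t) - p)"
    proof -
      have "norm (g (xh t) - g p) \<le> L * (r / 8)"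
        by (rule order_trans[OF lip[OF p zX] mult_left_mono]) (use z8 pos in auto)
      from mult_right_mono[OF this norm_ge_zero] show ?thesis
        unfolding norm_minus_commute[of p "x (Suc t)"] .
    qed
    finally have "\<gamma> * g (xh t) (p - x (Suc t)) \<le> \<gamma> * (L * (r / 8) * norm (x (Suc t) - p))"
      using pos by (intro mult_left_mono) auto
    also have "\<dots> \<le> 31 / 100 * (r / 8) * norm (x (Suc t) - p)" using pos by (intro \<gamma>L) auto
    finally show "D (x (Suc t)) (x t) \<le> D p (x t) + 31 / 100 * (r / 8) * norm (x (Suc t) - p)"
      using base(2)[OF p] D_nonneg[OF p base(1)] by simp
  qed (use pos xp Ds in auto)
  have zr: "norm (xh t - p) < r" using z8 pos by simp
  show desc: "E (Suc t) \<le> D p (x t) + 3 / 2 * (\<gamma> * L)\<^sup>2 * (norm (x t - xh (t - 1)))\<^sup>2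
      - 3 / 4 * (\<gamma> * \<mu>) * (norm (xh t - p))\<^sup>2 - (norm (xh t - x t))\<^sup>2 / 5"
    using step_descent[OF x zm lead(1) zr base(1) yr lead(2)[OF yX] base(2)[OF p]]
    by (simp add: E_def)
  show le: "E (Suc t) \<le> E t"
  proof -
    have "(\<gamma> * L)\<^sup>2 \<le> (31 / 100)\<^sup>2" using step(1) pos by (intro power_mono) auto
    then have "3 / 2 * (\<gamma> * L)\<^sup>2 * (norm (x t - xh (t - 1)))\<^sup>2 \<le> 1 / 4 * (norm (x t - xh (t - 1)))\<^sup>2"
    proof (intro mult_right_mono)
      assume "(\<gamma> * L)\<^sup>2 \<le> (31 / 100)\<^sup>2"
      also have "(31 / 100)\<^sup>2 \<le> (1 / 6 :: real)" by (simp add: power2_eq_square)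
      finally show "3 / 2 * (\<gamma> * L)\<^sup>2 \<le> 1 / 4" by (simp add: field_simps)
    qed simp
    moreover have "0 \<le> 3 / 4 * (\<gamma> * \<mu>) * (norm (xh t - p))\<^sup>2" using pos by simp
    moreover have "0 \<le> (norm (xh t - x t))\<^sup>2 / 5" by simp
    ultimately show ?thesis using desc unfolding E_def[of t] by linarith
  qed
  show "confined (Suc t)" using base(1) yr zX le E by (simp add: confined_def)
qed

lemma confined_all:
  assumes "norm (x 1 - p) < r" "D p (x 1) \<le> (r / 256)\<^sup>2" "1 \<le> t"
  shows "confined t"
  using assms(3)
proof (induction t rule: dec_induct)
  case base
  have "x 1 \<in> prox_dom h" "xh 0 = x 1" using bpm by (auto simp: bpm_def)
  then show ?case using assms(1,2) E_1 prox_dom_subset by (auto simp: confined_def)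
next
  case (step n)
  then show ?case using confined_step(1) by simp
qed

text \<open>The gains at the leading point become a gain in the distance of \<open>x t\<close>
  through \<open>(a + b)\<^sup>2 \<le> 2 * a\<^sup>2 + 2 * b\<^sup>2\<close>. The hypothesis
  \<open>\<mu> \<le> L\<close> gives \<open>\<gamma> * \<mu> \<le> 31 / 100\<close>, which leaves
  room for this and for contracting the memory term.\<close>

lemma energy_descent:
  assumes t: "1 \<le> t" and conf: "confined t" and \<mu>L: "\<mu> \<le> L"
  shows "E (Suc t) \<le> D p (x t) + (1 - \<gamma> * \<mu>) * ((norm (x t - xh (t - 1)))\<^sup>2 / 4)
    - \<gamma> * \<mu> / 4 * (norm (x t - p))\<^sup>2"
proof -
  have q: "(\<gamma> * L)\<^sup>2 \<le> (31 / 100)\<^sup>2" using step(1) pos by (intro power_mono) auto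
  have \<gamma>\<mu>: "\<gamma> * \<mu> \<le> 31 / 100" by (rule order_trans[OF mult_left_mono[OF \<mu>L] step(1)]) (use pos in simp)
  have "norm (x t - p) \<le> norm (xh t - x t) + norm (xh t - p)"
    using norm_triangle_ineq[of "x t - xh t" "xh t - p"] by (simp add: norm_minus_commute)
  then have "(norm (x t - p))\<^sup>2 \<le> (norm (xh t - x t) + norm (xh t - p))\<^sup>2" by (intro power_mono) auto
  also have "\<dots> \<le> 2 * (norm (xh t - x t))\<^sup>2 + 2 * (norm (xh t - p))\<^sup>2"
    using sum_squares_bound[of "norm (xh t - x t)" "norm (xh t - p)"] by (simp add: power2_sum)
  finally have "\<gamma> * \<mu> / 4 * (norm (x t - p))\<^sup>2
      \<le> \<gamma> * \<mu> / 4 * (2 * (norm (xh t - x t))\<^sup>2 + 2 * (norm (xh t - p))\<^sup>2)"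
    using pos by (intro mult_left_mono) auto
  moreover have "\<gamma> * \<mu> / 2 * (norm (xh t - x t))\<^sup>2 \<le> 1 / 5 * (norm (xh t - x t))\<^sup>2"
    using \<gamma>\<mu> by (intro mult_right_mono) auto
  moreover have "0 \<le> \<gamma> * \<mu> * (norm (xh t - p))\<^sup>2" using pos by simp
  moreover have "3 / 2 * (\<gamma> * L)\<^sup>2 * (norm (x t - xh (t - 1)))\<^sup>2
      \<le> (1 - \<gamma> * \<mu>) / 4 * (norm (x t - xh (t - 1)))\<^sup>2"
  proof (rule mult_right_mono)
    have "(\<gamma> * L)\<^sup>2 \<le> 961 / 10000" using q by (simp add: power2_eq_square)
    moreover have "3 / 2 * Q \<le> (1 - w) / 4" if "Q \<le> 961 / 10000" "w \<le> 31 / 100" for Q w :: real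
      using that by (simp add: field_simps)
    ultimately show "3 / 2 * (\<gamma> * L)\<^sup>2 \<le> (1 - \<gamma> * \<mu>) / 4" using \<gamma>\<mu> by blast
  qed simp
  moreover have "En \<le> d + (1 - w) * (e / 4) - w / 4 * n"
    if "w / 4 * n \<le> w / 4 * (2 * a + 2 * b)" "w / 2 * a \<le> 1 / 5 * a" "0 \<le> w * b"
      "s \<le> (1 - w) / 4 * e" "En \<le> d + s - 3 / 4 * w * b - a / 5" for En d w e n a b s :: real
  proof -
    have "w / 4 * n \<le> w / 2 * a + w / 2 * b" "(1 - w) / 4 * e = (1 - w) * (e / 4)" "3 / 4 * w * b = w / 2 * b + w * b / 4"
      using that(1) by (simp_all add: algebra_simps)
    then show ?thesis using that(2-) by linarith
  qed
  ultimately show ?thesis using confined_step(2)[OF t conf] by blast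
qed

end

section \<open>Convergence rates\<close>

context
  fixes x xh :: "nat \<Rightarrow> 'v" and K :: real
  assumes bpm: "bpm X h Dh g la lb (\<lambda>t. \<gamma>) x xh"
    and init: "norm (x 1 - p) < r" "D p (x 1) \<le> (r / 256)\<^sup>2"
    and \<mu>L: "\<mu> \<le> L" and K: "0 < K"
begin

text \<open>Quadratic growth turns the distance gain into \<open>c * D p (x n)\<close>, so
  divergence and memory term contract together.\<close>

lemma linear_rate:
  assumes growth: "\<And>y. y \<in> prox_dom h \<Longrightarrow> norm (y - p) < r \<Longrightarrow> D p y \<le> K / 2 * (norm (y - p))\<^sup>2"
    and K1: "1 \<le> K" and t: "1 \<le> t"
  shows "D p (x t) \<le> D p (x 1) * (1 - \<mu> * \<gamma> / (2 * K)) ^ (t - 1)"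
proof -
  note conf = confined_all[OF bpm init]
  let ?E = "E x xh"
  define c where "c = \<mu> * \<gamma> / (2 * K)"
  have \<gamma>\<mu>: "\<gamma> * \<mu> \<le> 31 / 100"
    by (rule order_trans[OF mult_left_mono[OF \<mu>L] step(1)]) (use pos in simp)
  \<comment> \<open>\<open>K \<ge> 1\<close> keeps \<open>c\<close> below the contraction rate
    \<open>\<gamma> * \<mu>\<close> of the memory term, so \<open>1 - c\<close> serves as a common
    factor.\<close>
  have "c * 1 \<le> c * (2 * K)" using K1 pos by (intro mult_left_mono) (auto simp: c_def)
  then have c: "c \<le> \<gamma> * \<mu>" using K by (simp add: c_def mult.commute)
  have "?E t \<le> ?E 1 * (1 - c) ^ (t - 1)"
    using t
  proof (induction t rule: dec_induct)
    case base
    then show ?case by simp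
  next
    case (step n)
    have cf: "confined x xh n" using conf[OF step(1)] .
    have "c * D p (x n) \<le> c * (K / 2 * (norm (x n - p))\<^sup>2)"
      using growth[of "x n"] cf pos K by (intro mult_left_mono) (auto simp: confined_def[OF bpm] c_def)
    also have "\<dots> = \<gamma> * \<mu> / 4 * (norm (x n - p))\<^sup>2" using K by (simp add: c_def)
    finally have 1: "c * D p (x n) \<le> \<gamma> * \<mu> / 4 * (norm (x n - p))\<^sup>2" .
    have 2: "(1 - \<gamma> * \<mu>) * ((norm (x n - xh (n - 1)))\<^sup>2 / 4) \<le> (1 - c) * ((norm (x n - xh (n - 1)))\<^sup>2 / 4)"
      using c by (intro mult_right_mono) auto
    note energy_descent[OF bpm step(1) cf \<mu>L]
    also have "D p (x n) + (1 - \<gamma> * \<mu>) * ((norm (x n - xh (n - 1)))\<^sup>2 / 4) - \<gamma> * \<mu> / 4 * (norm (x n - p))\<^sup>2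
        \<le> D p (x n) + (1 - c) * ((norm (x n - xh (n - 1)))\<^sup>2 / 4) - c * D p (x n)"
      using 1 2 by (intro diff_mono add_mono) auto
    also have "\<dots> = (1 - c) * ?E n" by (simp add: E_def[OF bpm] algebra_simps)
    also have "\<dots> \<le> (1 - c) * (?E 1 * (1 - c) ^ (n - 1))"
      using step.IH c \<gamma>\<mu> by (intro mult_left_mono) auto
    also have "\<dots> = ?E 1 * (1 - c) ^ (Suc n - 1)"
      using step(1) by (cases n) auto
    finally show ?case .
  qed
  moreover have "D p (x t) \<le> ?E t" by (simp add: E_def[OF bpm])
  ultimately show ?thesis using E_1[OF bpm] by (simp add: c_def)
qed

text \<open>With \<open>\<alpha> = \<beta> / (1 - \<beta>)\<close>, the growth bound raised to the
  power \<open>1 + \<alpha>\<close> is quadratic in the distance. The energy then satisfies the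
  hypothesis of \<open>powr_recursion_decay\<close>, whose exponent \<open>- (1 / \<alpha>)\<close>
  equals \<open>1 - 1 / \<beta>\<close>.\<close>

lemma sublinear_rate:
  assumes growth: "\<And>y. y \<in> prox_dom h \<Longrightarrow> norm (y - p) < r \<Longrightarrow>
      D p y \<le> K / 2 * norm (y - p) powr (2 * (1 - \<beta>))"
    and \<beta>: "0 < \<beta>" "\<beta> < 1" and t: "1 \<le> t"
  shows "D p (x t) \<le> D p (x 1) *
    (1 + rate_const \<beta> K (D p (x 1)) * \<mu> * \<gamma> * real (t - 1)) powr (1 - 1 / \<beta>)"
proof -
  note conf = confined_all[OF bpm init]
  \<comment> \<open>The shift makes the recursion start at index \<open>0\<close>, so that
    \<open>t - 1\<close> counts its steps.\<close>
  define u where "u n = E x xh (Suc n)" for n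
  define d where "d = D p (x 1)"
  have u0: "u 0 = d" using E_1[OF bpm] by (simp add: u_def d_def)
  have cf: "confined x xh (Suc n)" for n using conf by simp
  have Dn: "0 \<le> D p (x (Suc n))" for n
    using D_nonneg[OF p] cf[of n] by (simp add: confined_def[OF bpm])
  have Du: "D p (x (Suc n)) \<le> u n" for n by (simp add: u_def E_def[OF bpm])
  have un: "0 \<le> u n" for n using Dn Du order_trans by blast
  have "u (Suc n) \<le> u n" for n using confined_step(3)[OF bpm _ cf[of n]] by (simp add: u_def)
  then have ud: "u n \<le> d" for n using u0 by (metis lift_Suc_antimono_le zero_le)
  obtain n where n: "t = Suc n" using t by (cases t) auto
  show ?thesis
  \<comment> \<open>If the initial divergence vanishes, the nonincreasing energy keeps all later
    divergences at zero.\<close>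
  proof (cases "d = 0")
    case True
    then show ?thesis using ud[of n] Du[of n] by (simp add: n d_def)
  next
    case False
    then have d: "0 < d" using un[of 0] u0 by simp
    define \<alpha> where "\<alpha> = \<beta> / (1 - \<beta>)"
    have \<alpha>: "0 < \<alpha>" using \<beta> by (simp add: \<alpha>_def)
    have \<alpha>1: "1 / (1 - \<beta>) = 1 + \<alpha>" using \<beta> by (simp add: \<alpha>_def field_simps)
    have \<alpha>2: "1 - 1 / \<beta> = - (1 / \<alpha>)" using \<beta> by (simp add: \<alpha>_def field_simps)
    \<comment> \<open>The first entry of the maximum controls the divergence part of the energy, the
      second the memory part.\<close>
    define M where "M = max (2 * K powr (1 + \<alpha>) * d powr - \<alpha>) (2 powr \<alpha>)"
    have M: "2 * K powr (1 + \<alpha>) * d powr - \<alpha> \<le> M" "2 powr \<alpha> \<le> M" by (auto simp: M_def)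
    have M0: "0 < M" using M(2) by (smt (verit) powr_gt_zero)
    define m where "m = \<mu> * \<gamma> / M"
    have m: "0 < m" using pos M0 by (simp add: m_def)
    have "u n \<le> u 0 * (1 + \<alpha> * m * real n) powr (- (1 / \<alpha>))"
    proof (rule powr_recursion_decay[OF \<alpha>])
      show "0 \<le> m" "0 < u 0" "\<And>n. 0 \<le> u n" using m d u0 un by auto
      fix n
      define a where "a = D p (x (Suc n))"
      define f where "f = (norm (x (Suc n) - xh n))\<^sup>2 / 4"
      define N where "N = norm (x (Suc n) - p)"
      have af: "u n = a + f" "0 \<le> a" "0 \<le> f"
        using Dn[of n] by (auto simp: u_def a_def f_def E_def[OF bpm])
      have "a powr (1 + \<alpha>) \<le> (K / 2 * N powr (2 * (1 - \<beta>))) powr (1 + \<alpha>)"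
        using growth[of "x (Suc n)"] cf[of n] af \<alpha>
        by (intro powr_mono2) (auto simp: confined_def[OF bpm] a_def N_def)
      also have "\<dots> = (K / 2) powr (1 + \<alpha>) * N powr (2 * (1 - \<beta>) * (1 + \<alpha>))"
        using powr_mult[of "K / 2" "N powr (2 * (1 - \<beta>))" "1 + \<alpha>"] K unfolding powr_powr by simp
      also have "2 * (1 - \<beta>) * (1 + \<alpha>) = 2" using \<beta> by (simp add: \<alpha>1[symmetric] field_simps)
      also have "N powr 2 = N\<^sup>2" by (simp add: N_def)
      finally have a_le: "a powr (1 + \<alpha>) \<le> (K / 2) powr (1 + \<alpha>) * N\<^sup>2" .
      have 1: "m * d powr - \<alpha> * (2 powr \<alpha> * a powr (1 + \<alpha>)) \<le> \<gamma> * \<mu> / 4 * N\<^sup>2"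
      proof -
        have "m * d powr - \<alpha> * (2 powr \<alpha> * a powr (1 + \<alpha>))
            \<le> m * d powr - \<alpha> * (2 powr \<alpha> * ((K / 2) powr (1 + \<alpha>) * N\<^sup>2))"
          using a_le m by (intro mult_left_mono) auto
        \<comment> \<open>The product \<open>2 powr \<alpha> * (K / 2) powr (1 + \<alpha>)\<close>
          is half of \<open>K powr (1 + \<alpha>)\<close>; against the factor \<open>1 / 4\<close>
          this explains the \<open>2\<close> in the rate constant.\<close>
        also have "\<dots> = \<gamma> * \<mu> / 4 * N\<^sup>2 * (2 * K powr (1 + \<alpha>) * d powr - \<alpha> / M)"
          using K by (simp add: m_def powr_divide powr_add field_simps)
        also have "\<dots> \<le> \<gamma> * \<mu> / 4 * N\<^sup>2 * 1"
          using M(1) M0 pos by (intro mult_left_mono) auto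
        finally show ?thesis by simp
      qed
      have 2: "m * d powr - \<alpha> * (2 powr \<alpha> * f powr (1 + \<alpha>)) \<le> \<gamma> * \<mu> * f"
      proof -
        \<comment> \<open>The memory part never exceeds the initial energy \<open>d\<close>, so its
          higher power is dominated by a linear term.\<close>
        have "f powr \<alpha> \<le> d powr \<alpha>"
          using af ud[of n] \<alpha> by (intro powr_mono2) auto
        then have "m * d powr - \<alpha> * (2 powr \<alpha> * (f * f powr \<alpha>))
            \<le> m * d powr - \<alpha> * (2 powr \<alpha> * (f * d powr \<alpha>))"
          using m af by (intro mult_left_mono) auto
        also have "\<dots> = \<gamma> * \<mu> * f * (2 powr \<alpha> / M)"
          using d by (simp add: m_def powr_minus field_simps)
        also have "\<dots> \<le> \<gamma> * \<mu> * f * 1"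
          using M(2) M0 pos af by (intro mult_left_mono) auto
        finally show ?thesis using af by (simp add: powr_add powr_one)
      qed
      have "m * d powr - \<alpha> * u n powr (1 + \<alpha>)
          \<le> m * d powr - \<alpha> * (2 powr \<alpha> * (a powr (1 + \<alpha>) + f powr (1 + \<alpha>)))"
        unfolding af(1) using powr_add_le[OF af(2,3), of \<alpha>] \<alpha> m by (intro mult_left_mono) auto
      also have "\<dots> \<le> \<gamma> * \<mu> / 4 * N\<^sup>2 + \<gamma> * \<mu> * f"
        using 1 2 by (simp add: distrib_left)
      finally have "m * u 0 powr - \<alpha> * u n powr (1 + \<alpha>) \<le> \<gamma> * \<mu> / 4 * N\<^sup>2 + \<gamma> * \<mu> * f"
        by (simp add: u0)
      moreover have "u (Suc n) \<le> a + (1 - \<gamma> * \<mu>) * f - \<gamma> * \<mu> / 4 * N\<^sup>2"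
        using energy_descent[OF bpm _ cf[of n] \<mu>L] by (simp add: u_def a_def f_def N_def)
      moreover have "(1 - \<gamma> * \<mu>) * f = f - \<gamma> * \<mu> * f" by (simp add: algebra_simps)
      ultimately show "u (Suc n) \<le> u n - m * u 0 powr - \<alpha> * u n powr (1 + \<alpha>)"
        using af(1) by linarith
    qed
    moreover have "\<alpha> * m = rate_const \<beta> K d * \<mu> * \<gamma>"
    proof -
      have "rate_const \<beta> K d = \<alpha> * inverse M"
        using False unfolding rate_const_def M_def \<alpha>1 \<alpha>_def[symmetric] by simp
      then show ?thesis by (simp add: m_def divide_inverse)
    qed
    ultimately show ?thesis using Du[of n] \<alpha>2 u0 by (simp add: n d_def)
  qed
qed

end

end

section \<open>Common radius, initial neighbourhood and choice of the rate\<close>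

theorem theorem1:
  fixes X B U :: "'v::real_normed_vector set"
    and h :: "'v \<Rightarrow> ereal"
    and Dh g :: "'v \<Rightarrow> 'v \<Rightarrow>\<^sub>L real"
    and xs :: 'v
    and L \<mu> K \<beta> \<gamma> la lb \<phi> :: real
  assumes fin_dim: "\<exists>S :: 'v set. finite S \<and> span S = UNIV"
    and X: "closed X" "convex X"
    and sol: "xs \<in> X" "\<forall>x\<in>X. blinfun_apply (g xs) (x - xs) \<ge> 0"
    and lip: "L-lipschitz_on X g"
    and B: "nhd_in X xs B" "convex B"
    and \<mu>: "\<mu> > 0"
      "\<forall>x\<in>B. blinfun_apply (g x - g xs) (x - xs) \<ge> \<mu> * (norm (x - xs))\<^sup>2"
    and h: "bregman_regularizer X h Dh" "legendre_tight h Dh xs"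
    and \<beta>: "\<beta> = legendre_exponent h Dh xs" "0 \<le> \<beta>" "\<beta> < 1"
    and U: "nhd_in X xs U" "strongly_convex_on 1 h Dh U"
    and K: "K > 0"
      "\<forall>x \<in> U \<inter> prox_dom h.
         bregman_div h Dh xs x \<le> K / 2 * norm (x - xs) powr (2 * (1 - \<beta>))"
    and lambda: "la \<in> {0..1}" "lb \<in> {0..1}" "la + lb \<le> 1" "lb > 0 \<longrightarrow> la + lb = 1"
    and \<phi>: "\<phi> = (sqrt 5 + 1) / 2"
    and \<gamma>: "\<gamma> > 0" "\<gamma> \<le> 1 / (2 * \<phi> * L)" "\<gamma> * (1 - la - lb)\<^sup>2 \<le> \<mu> / (8 * L\<^sup>2)"
  shows "\<exists>U\<^sub>1. nhd_in X xs U\<^sub>1 \<and>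
    (\<forall>x xh :: nat \<Rightarrow> 'v. bpm X h Dh g la lb (\<lambda>t. \<gamma>) x xh \<and> x 1 \<in> U\<^sub>1 \<inter> prox_dom h \<longrightarrow>
      (\<forall>t\<ge>1. bregman_div h Dh xs (x t) \<le> bregman_div h Dh xs (x 1) *
         (if \<beta> = 0 then (1 - \<mu> * \<gamma> / (2 * K)) ^ (t - 1)
          else (1 + rate_const \<beta> K (bregman_div h Dh xs (x 1)) * \<mu> * \<gamma> * real (t - 1))
                 powr (1 - 1 / \<beta>))))"
proof -
  interpret bregman X h Dh
    using fin_dim X h(1) by unfold_locales
  have L0: "0 \<le> L" using lip by (rule lipschitz_on_nonneg)
  \<comment> \<open>With \<open>L = 0\<close> the step-size bound is a division by zero, hence
    \<open>0\<close>, and contradicts \<open>\<gamma> > 0\<close>.\<close>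
  have "L \<noteq> 0" using \<gamma>(1,2) by auto
  with L0 have L: "0 < L" by simp
  have ball: "\<exists>e>0. ball xs e \<inter> X \<subseteq> V" if "nhd_in X xs V" for V
    using that unfolding nhd_in_def openin_contains_ball by (meson subset_trans)
  obtain r1 where r1: "r1 > 0" "ball xs r1 \<inter> X \<subseteq> B" using ball[OF B(1)] by blast
  obtain r2 where r2: "r2 > 0" "ball xs r2 \<inter> X \<subseteq> U" using ball[OF U(1)] by blast
  have UX: "U \<subseteq> X" using U(1) by (simp add: nhd_in_def)
  define r where "r = min r1 r2"
  have r: "0 < r" using r1 r2 by (simp add: r_def)
  have inB: "y \<in> B" and inU: "y \<in> U" if "y \<in> X" "norm (y - xs) < r" for y
    using that r1 r2 by (auto simp: r_def dist_norm norm_minus_commute)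
  have lip': "norm (g x' - g x) \<le> L * norm (x' - x)" if "x \<in> X" "x' \<in> X" for x x'
    using lipschitz_onD[OF lip that(2,1)] by (simp add: dist_norm)
  have sc: "(norm (x' - x))\<^sup>2 / 2 \<le> D x' x"
    if "x \<in> prox_dom h" "norm (x - xs) < r" "x' \<in> X" "norm (x' - xs) < r" for x x'
    using D_strong[OF U(2) UX, of x x'] inU that prox_dom_subset by auto
  have \<gamma>L: "\<gamma> * L \<le> 31 / 100"
  proof -
    \<comment> \<open>This precision suffices: \<open>2 * \<phi> \<ge> 3.23\<close>, and
      \<open>0.31 * 3.23\<close> exceeds \<open>1\<close>.\<close>
    have "sqrt 5 \<ge> 2.23" by (rule real_le_rsqrt) (simp add: power2_eq_square)
    then have \<phi>': "31 / 100 * (2 * \<phi>) \<ge> 1" "\<phi> > 0" using \<phi> by auto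
    have "\<gamma> * L \<le> 1 / (2 * \<phi> * L) * L" using \<gamma>(2) L by (intro mult_right_mono) auto
    also have "\<dots> = 1 / (2 * \<phi>)" using L by simp
    also have "\<dots> \<le> 31 / 100" using \<phi>' by (simp add: field_simps)
    finally show ?thesis .
  qed
  have "\<gamma> * (1 - la - lb)\<^sup>2 * L\<^sup>2 \<le> \<mu> / (8 * L\<^sup>2) * L\<^sup>2" using \<gamma>(3) by (intro mult_right_mono) auto
  also have "\<dots> = \<mu> / 8" using L by simp
  finally have step2: "\<gamma> * (1 - la - lb)\<^sup>2 * L\<^sup>2 \<le> \<mu> / 8" .
  interpret bpm_local X h Dh g xs L \<mu> \<gamma> la lb r
    using sol lip' L \<mu> \<gamma>(1) r inB sc \<gamma>L step2 lambda by unfold_locales auto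
  define \<epsilon> where "\<epsilon> = (r / 256)\<^sup>2"
  have \<epsilon>: "0 < \<epsilon>" using r by (simp add: \<epsilon>_def)
  \<comment> \<open>The second radius inverts the growth bound, so that starting within it makes the
    initial divergence at most \<open>\<epsilon>\<close>.\<close>
  define \<delta> where "\<delta> = min r ((2 * \<epsilon> / K) powr (1 / (2 * (1 - \<beta>))))"
  have \<delta>: "0 < \<delta>" "\<delta> \<le> r" using r \<epsilon> K(1) by (auto simp: \<delta>_def)
  have init: "norm (y - xs) < r" "D xs y \<le> \<epsilon>" if y: "y \<in> prox_dom h" "norm (y - xs) < \<delta>" for y
  proof -
    show nr: "norm (y - xs) < r" using y(2) \<delta>(2) by simp
    have "norm (y - xs) powr (2 * (1 - \<beta>)) \<le> ((2 * \<epsilon> / K) powr (1 / (2 * (1 - \<beta>)))) powr (2 * (1 - \<beta>))"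
      using y(2) \<beta>(3) by (intro powr_mono2) (auto simp: \<delta>_def)
    also have "\<dots> = 2 * \<epsilon> / K" using \<epsilon> K(1) \<beta>(3) by (simp add: powr_powr)
    finally have "K / 2 * norm (y - xs) powr (2 * (1 - \<beta>)) \<le> \<epsilon>" using K(1) by (simp add: field_simps)
    then show "D xs y \<le> \<epsilon>" using K(2) inU[OF _ nr] y(1) prox_dom_subset by (meson IntI order_trans subsetD)
  qed
  show ?thesis
  proof (intro exI[of _ "X \<inter> ball xs \<delta>"] conjI allI impI)
    show "nhd_in X xs (X \<inter> ball xs \<delta>)"
      unfolding nhd_in_def using sol(1) \<delta>(1)
      by (intro conjI exI[of _ "X \<inter> ball xs \<delta>"]) (auto simp: openin_open_Int)
    fix x xh :: "nat \<Rightarrow> 'v" and t :: nat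
    assume *: "bpm X h Dh g la lb (\<lambda>t. \<gamma>) x xh \<and> x 1 \<in> (X \<inter> ball xs \<delta>) \<inter> prox_dom h" and t: "1 \<le> t"
    then have bpm: "bpm X h Dh g la lb (\<lambda>t. \<gamma>) x xh" and x1: "norm (x 1 - xs) < r" "D xs (x 1) \<le> (r / 256)\<^sup>2"
      using init[of "x 1"] by (auto simp: dist_norm norm_minus_commute \<epsilon>_def)
    show "D xs (x t) \<le> D xs (x 1) *
         (if \<beta> = 0 then (1 - \<mu> * \<gamma> / (2 * K)) ^ (t - 1)
          else (1 + rate_const \<beta> K (D xs (x 1)) * \<mu> * \<gamma> * real (t - 1)) powr (1 - 1 / \<beta>))"
    \<comment> \<open>If the iterates never leave the solution, both sides are zero. Otherwise an
      iterate different from \<open>xs\<close> witnesses the compatibility of the constants,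
      \<open>\<mu> \<le> L\<close> and, for \<open>\<beta> = 0\<close>,
      \<open>1 \<le> K\<close>.\<close>
    proof (cases "\<forall>t\<ge>1. x t = xs")
      case True
      then show ?thesis using t by (simp add: D_eq)
    next
      case False
      then obtain s where s: "1 \<le> s" "x s \<noteq> xs" by blast
      have "confined x xh s" by (rule confined_all[OF bpm x1 s(1)])
      then have xs: "x s \<in> prox_dom h" "norm (x s - xs) < r" by (auto simp: confined_def[OF bpm])
      then have xsX: "x s \<in> X" using prox_dom_subset by blast
      let ?n = "norm (x s - xs)"
      have n: "0 < ?n\<^sup>2" using s(2) by simp
      have "\<mu> * ?n\<^sup>2 \<le> (g (x s) - g xs) (x s - xs)" using strong_mono[OF xsX xs(2)] .
      also have "\<dots> \<le> norm (g (x s) - g xs) * ?n"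
        using norm_blinfun[of "g (x s) - g xs" "x s - xs"] by simp
      also have "\<dots> \<le> L * ?n * ?n" using lip'[OF sol(1) xsX] by (intro mult_right_mono) auto
      finally have "\<mu> * ?n\<^sup>2 \<le> L * ?n\<^sup>2" by (simp add: power2_eq_square)
      then have \<mu>L: "\<mu> \<le> L" using n by simp
      have growth: "D xs y \<le> K / 2 * norm (y - xs) powr (2 * (1 - \<beta>))"
        if "y \<in> prox_dom h" "norm (y - xs) < r" for y
        using K(2) inU that prox_dom_subset by blast
      show ?thesis
      proof (cases "\<beta> = 0")
        case True
        have growth': "D xs y \<le> K / 2 * (norm (y - xs))\<^sup>2"
          if "y \<in> prox_dom h" "norm (y - xs) < r" for y
          using growth[OF that] True by simp
        \<comment> \<open>Strong convexity bounds the divergence at \<open>x s\<close> from below,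
          growth bounds it from above; comparing the two gives \<open>K \<ge> 1\<close>.\<close>
        have "?n\<^sup>2 / 2 \<le> K / 2 * ?n\<^sup>2"
          using sc[OF xs sol(1)] r growth'[OF xs] by (simp add: norm_minus_commute)
        then have "1 \<le> K" using n by simp
        then show ?thesis using linear_rate[OF bpm x1 \<mu>L K(1) growth' _ t] True by simp
      next
        case False
        then show ?thesis using sublinear_rate[OF bpm x1 \<mu>L K(1) growth _ \<beta>(3) t] \<beta>(2) by simp
      qed
    qed
  qed
qed

end
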